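(* Let $\tau>\omega$ be a cardinal, let $\Pi=P\mathbb Z_2^\tau$, and let $\xi$ be an ultrafilter on $\tau$ containing the complements (in $\tau$) of all countable subsets of $\tau$. Then the subgroup $$G_\xi=\{x\in\Pi:\operatorname{supp}(x)\notin\xi\}$$ of $\Pi$, with the topology inherited from $\Pi$, is a nondiscrete $P$-group and is reflexive.
   Context: A $P$-group is a topological group in which every $G_\delta$-set is open. $\mathbb T=\{z\in\mathbb C:|z|=1\}$ is the circle group. For a topological Abelian group $G$, $G^\wedge$ is the group of continuous characters (continuous homomorphisms $G\to\mathbb T$) with the topology of uniform convergence on compact subsets of $G$. $G$ is reflexive if the evaluation homomorphism $\alpha_G:G\to G^{\wedge\wedge}$, $\alpha_G(x)(\chi)=\chi(x)$, is a topological isomorphism of $G$ onto $G^{\wedge\wedge}=(G^\wedge)^\wedge$. For a topological group $H$, $PH$ ($P$-modification) is the same group with the finer group topology whose base consists of all $G_\delta$-sets of $H$. $\mathbb Z_2=\{0,1\}$ is the discrete two-element group and $\mathbb Z_2^\tau$ carries the Tychonoff product topology. For $x\in\mathbb Z_2^\tau$, $\operatorname{supp}(x)=\{i\in\tau:x(i)\ne0\}$. *)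

theory Defs
  imports "HOL-Analysis.Analysis" "HOL-Algebra.Product_Groups"
begin

(* A topological group is a HOL-Algebra group G together with an abstract topology T on
   carrier G.  No separation axiom is imposed. *)

definition topological_group :: "('a, 'b) monoid_scheme \<Rightarrow> 'a topology \<Rightarrow> bool" where
  "topological_group G T \<longleftrightarrow>
     group G \<and> topspace T = carrier G \<and>
     continuous_map (prod_topology T T) T (\<lambda>(x, y). x \<otimes>\<^bsub>G\<^esub> y) \<and>
     continuous_map T T (\<lambda>x. inv\<^bsub>G\<^esub> x)"

definition P_group :: "('a, 'b) monoid_scheme \<Rightarrow> 'a topology \<Rightarrow> bool" where
  "P_group G T \<longleftrightarrow> topological_group G T \<and> (\<forall>S. gdelta_in T S \<longrightarrow> openin T S)"

definition P_modification :: "'a topology \<Rightarrow> 'a topology" where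
  "P_modification T = topology (arbitrary union_of gdelta_in T)"

lemma openin_P_modification:
  "openin (P_modification T) = arbitrary union_of gdelta_in T"
  unfolding P_modification_def
  by (intro topology_inverse' istopology_base gdelta_in_Int)

lemma topspace_P_modification [simp]: "topspace (P_modification T) = topspace T"
proof
  show "topspace (P_modification T) \<subseteq> topspace T"
    using openin_topspace[of "P_modification T"] gdelta_in_subset
    unfolding openin_P_modification union_of_def by fastforce
  have "openin (P_modification T) (topspace T)"
    unfolding openin_P_modification by (simp add: arbitrary_union_of_inc)
  then show "topspace T \<subseteq> topspace (P_modification T)"
    by (rule openin_subset)
qed

definition circle_group :: "complex monoid" where
  "circle_group = \<lparr>carrier = sphere 0 1, monoid.mult = (*), one = 1\<rparr>"

definition circle_topology :: "complex topology" where
  "circle_topology = top_of_set (sphere 0 1)"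

(* Characters are extensional (undefined outside carrier G), so that HOL equality of
   characters is equality as functions on G. *)

definition dual_group :: "('a, 'b) monoid_scheme \<Rightarrow> 'a topology \<Rightarrow> ('a \<Rightarrow> complex) monoid" where
  "dual_group G T =
     \<lparr>carrier = {\<phi> \<in> extensional (carrier G).
                   \<phi> \<in> hom G circle_group \<and> continuous_map T circle_topology \<phi>},
      monoid.mult = (\<lambda>\<phi> \<psi>. \<lambda>x\<in>carrier G. \<phi> x * \<psi> x),
      one = (\<lambda>x\<in>carrier G. 1)\<rparr>"

(* Topology of uniform convergence on compact sets: U is open iff, with each of its points,
   it contains a basic uniform neighbourhood given by some compact K and some e > 0. *)

definition dual_open :: "('a, 'b) monoid_scheme \<Rightarrow> 'a topology \<Rightarrow> ('a \<Rightarrow> complex) set \<Rightarrow> bool" where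
  "dual_open G T U \<longleftrightarrow>
     U \<subseteq> carrier (dual_group G T) \<and>
     (\<forall>\<phi>\<in>U. \<exists>K e. compactin T K \<and> e > 0 \<and>
        {\<psi> \<in> carrier (dual_group G T). \<forall>x\<in>K. dist (\<psi> x) (\<phi> x) < e} \<subseteq> U)"

definition dual_topology :: "('a, 'b) monoid_scheme \<Rightarrow> 'a topology \<Rightarrow> ('a \<Rightarrow> complex) topology" where
  "dual_topology G T = topology (dual_open G T)"

lemma istopology_dual_open: "istopology (dual_open G T)"
  unfolding istopology_def
proof (intro conjI allI impI)
  fix U V
  assume U: "dual_open G T U" and V: "dual_open G T V"
  show "dual_open G T (U \<inter> V)"
    unfolding dual_open_def
  proof (intro conjI ballI)
    show "U \<inter> V \<subseteq> carrier (dual_group G T)"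
      using U by (auto simp: dual_open_def)
    fix \<phi> assume \<phi>: "\<phi> \<in> U \<inter> V"
    obtain K d where K: "compactin T K" "d > 0"
      "{\<psi> \<in> carrier (dual_group G T). \<forall>x\<in>K. dist (\<psi> x) (\<phi> x) < d} \<subseteq> U"
      using U \<phi> unfolding dual_open_def by blast
    obtain L e where L: "compactin T L" "e > 0"
      "{\<psi> \<in> carrier (dual_group G T). \<forall>x\<in>L. dist (\<psi> x) (\<phi> x) < e} \<subseteq> V"
      using V \<phi> unfolding dual_open_def by blast
    have "compactin T (K \<union> L)" "min d e > 0"
      using K L by (auto intro: compactin_Un)
    moreover have "{\<psi> \<in> carrier (dual_group G T). \<forall>x\<in>K \<union> L. dist (\<psi> x) (\<phi> x) < min d e} \<subseteq> U \<inter> V"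
      using K(3) L(3) by auto
    ultimately show "\<exists>K e. compactin T K \<and> e > 0 \<and>
        {\<psi> \<in> carrier (dual_group G T). \<forall>x\<in>K. dist (\<psi> x) (\<phi> x) < e} \<subseteq> U \<inter> V"
      by blast
  qed
next
  fix \<U>
  assume "\<forall>U\<in>\<U>. dual_open G T U"
  then show "dual_open G T (\<Union>\<U>)"
    unfolding dual_open_def by (meson Sup_least UnionE Union_upper subset_trans)
qed

lemma openin_dual_topology: "openin (dual_topology G T) = dual_open G T"
  unfolding dual_topology_def by (rule topology_inverse'[OF istopology_dual_open])

lemma topspace_dual_topology [simp]:
  "topspace (dual_topology G T) = carrier (dual_group G T)"
proof
  show "topspace (dual_topology G T) \<subseteq> carrier (dual_group G T)"
    using openin_topspace[of "dual_topology G T"]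
    unfolding openin_dual_topology dual_open_def by blast
  have "dual_open G T (carrier (dual_group G T))"
    unfolding dual_open_def
    by (intro conjI ballI subset_refl exI[of _ "{}"] exI[of _ "1::real"]) auto
  then show "carrier (dual_group G T) \<subseteq> topspace (dual_topology G T)"
    by (metis openin_dual_topology openin_subset)
qed

definition evaluation ::
  "('a, 'b) monoid_scheme \<Rightarrow> 'a topology \<Rightarrow> 'a \<Rightarrow> ('a \<Rightarrow> complex) \<Rightarrow> complex" where
  "evaluation G T x = (\<lambda>\<phi>\<in>carrier (dual_group G T). \<phi> x)"

definition reflexive_group :: "('a, 'b) monoid_scheme \<Rightarrow> 'a topology \<Rightarrow> bool" where
  "reflexive_group G T \<longleftrightarrow>
     topological_group G T \<and> comm_group G \<and>
     evaluation G T \<in> iso G (dual_group (dual_group G T) (dual_topology G T)) \<and>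
     homeomorphic_map T (dual_topology (dual_group G T) (dual_topology G T)) (evaluation G T)"

definition filter_on :: "'i set \<Rightarrow> 'i set set \<Rightarrow> bool" where
  "filter_on I F \<longleftrightarrow>
     F \<subseteq> Pow I \<and> I \<in> F \<and> {} \<notin> F \<and>
     (\<forall>A\<in>F. \<forall>B\<in>F. A \<inter> B \<in> F) \<and>
     (\<forall>A\<in>F. \<forall>B. A \<subseteq> B \<and> B \<subseteq> I \<longrightarrow> B \<in> F)"

definition ultrafilter_on :: "'i set \<Rightarrow> 'i set set \<Rightarrow> bool" where
  "ultrafilter_on I F \<longleftrightarrow>
     filter_on I F \<and> (\<forall>F'. filter_on I F' \<and> F \<subseteq> F' \<longrightarrow> F' = F)"

definition Z2_power :: "'i set \<Rightarrow> ('i \<Rightarrow> int) monoid" where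
  "Z2_power I = product_group I (\<lambda>_. integer_mod_group 2)"

definition Z2_power_topology :: "'i set \<Rightarrow> ('i \<Rightarrow> int) topology" where
  "Z2_power_topology I =
     product_topology (\<lambda>_. discrete_topology (carrier (integer_mod_group 2))) I"

definition supp :: "'i set \<Rightarrow> ('i \<Rightarrow> int) \<Rightarrow> 'i set" where
  "supp I x = {i \<in> I. x i \<noteq> 0}"

definition G_sub :: "'i set \<Rightarrow> 'i set set \<Rightarrow> ('i \<Rightarrow> int) set" where
  "G_sub I \<xi> = {x \<in> carrier (Z2_power I). supp I x \<notin> \<xi>}"

definition G_group :: "'i set \<Rightarrow> 'i set set \<Rightarrow> ('i \<Rightarrow> int) monoid" where
  "G_group I \<xi> = (Z2_power I)\<lparr>carrier := G_sub I \<xi>\<rparr>"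

definition G_topology :: "'i set \<Rightarrow> 'i set set \<Rightarrow> ('i \<Rightarrow> int) topology" where
  "G_topology I \<xi> = subtopology (P_modification (Z2_power_topology I)) (G_sub I \<xi>)"

end

theory Submission
  imports Defs "HOL-Library.Countable_Set_Type"
begin

text \<open>A compact subset of a \<open>P\<close>-group is finite, so the dual \<open>H\<close> of \<open>G = G_\<xi>\<close> carries the topology of
  pointwise convergence on \<open>G\<close>. Its elements are the homomorphisms to \<open>{1, -1}\<close> supported by a
  countable set of coordinates. A continuous character of \<open>H\<close> vanishes on the annihilator of a
  finite subset of \<open>G\<close>, hence is an evaluation by linear algebra over the field with two elements.
  The evaluation map is open because the characters supported by a fixed countable set form a
  compact subset of \<open>H\<close> (Tychonoff).

  Continuity of the evaluation map means that every compact \<open>K \<subseteq> H\<close> has a common countable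
  support. Otherwise, recursion along \<open>\<omega>\<^sub>1\<close> yields \<open>\<phi>\<^sub>a \<in> K\<close> and disjointly supported
  \<open>x\<^sub>a \<in> G\<close> with \<open>\<phi>\<^sub>a(x\<^sub>a) = -1\<close> and \<open>\<phi>\<^sub>b(x\<^sub>a) = 1\<close> for \<open>b < a\<close>. Split \<open>\<omega>\<^sub>1\<close> into two uncountable
  sets; the corresponding unions of supports are disjoint, so one of them, say the one given by \<open>C\<close>,
  is not in \<open>\<xi>\<close>, and all (infinite) sums of \<open>x\<^sub>a\<close> with \<open>a \<in> C\<close> lie in \<open>G\<close>. By triangularity, every
  \<open>C' \<subseteq> C\<close> admits such a sum \<open>x\<close> with \<open>\<phi>\<^sub>a(x) = -1\<close> for all \<open>a \<in> C'\<close>. For \<open>\<phi> \<in> K\<close>, take \<open>C'\<close> to be all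
  but the countably many \<open>a \<in> C\<close> for which the support of \<open>x\<^sub>a\<close> meets that of \<open>\<phi>\<close>: the resulting
  neighbourhood of \<open>\<phi>\<close> contains \<open>\<phi>\<^sub>a\<close> for only countably many \<open>a \<in> C\<close>, contradicting compactness.\<close>

section \<open>Compact families of countably supported functionals\<close>

context
  includes cardinal_syntax
begin

text \<open>The order is the successor cardinal of \<open>natLeq\<close>, that is
  \<open>\<omega>\<^sub>1\<close>, which \<open>cardSuc\<close> realises on sets of naturals; hence
  the type \<open>nat set\<close>. Proper initial segments of a cardinal order have smaller
  cardinality, so here they are countable. Removing \<open>Id\<close> makes the well-order
  strict.\<close>

lemma ex_uncountable_order_countable_segments:
  "\<exists>(W :: nat set set) r. wf r \<and> total_on W r \<and> uncountable W \<and> (\<forall>a. countable {b. (b, a) \<in> r})"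
proof -
  define c where "c = cardSuc natLeq"
  have co: "Card_order c"
    unfolding c_def by (rule cardSuc_Card_order[OF natLeq_Card_order])
  then have wo: "well_order_on (Field c) c"
    using card_order_on_well_order_on by blast
  have "natLeq <o c"
    unfolding c_def by (rule cardSuc_greater[OF natLeq_Card_order])
  then have "natLeq <o |Field c|"
    using ordLess_ordIso_trans[OF _ ordIso_symmetric[OF card_of_Field_ordIso[OF co]]] by blast
  then have unc: "uncountable (Field c)"
    unfolding countable_card_le_natLeq using not_ordLess_ordLeq by blast
  have "countable {b. (b, a) \<in> c - Id}" for a
  proof (cases "a \<in> Field c")
    case True
    have "|underS c a| <o c"
      using card_of_underS[OF co True] .
    then have "|underS c a| \<le>o natLeq"
      unfolding c_def using cardSuc_ordLeq_ordLess[OF natLeq_Card_order card_of_Card_order] by blast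
    then have "countable (underS c a)"
      by (simp add: countable_card_le_natLeq)
    moreover have "{b. (b, a) \<in> c - Id} = underS c a"
      by (auto simp: underS_def)
    ultimately show ?thesis by simp
  next
    case False
    then have "{b. (b, a) \<in> c - Id} = {}"
      by (auto simp: Field_def)
    then show ?thesis by (simp only: countable_empty)
  qed
  moreover have "wf (c - Id)" "total_on (Field c) (c - Id)"
    using wo by (auto simp: well_order_on_def linear_order_on_def)
  ultimately show ?thesis
    using unc by blast
qed

text \<open>An infinite set is in bijection with two disjoint copies of itself; the images of the
  two copies are the required pieces.\<close>

lemma uncountable_split:
  assumes "uncountable W"
  shows "\<exists>C D. C \<subseteq> W \<and> D \<subseteq> W \<and> C \<inter> D = {} \<and> uncountable C \<and> uncountable D"
proof -
  have "infinite W"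
    using assms uncountable_infinite by blast
  then have "|W <+> W| =o |W|"
    using card_of_Plus_infinite1[OF _ card_of_mono1[OF subset_refl]] by blast
  then obtain h where h: "bij_betw h (W <+> W) W"
    using card_of_ordIso by blast
  then have inj: "inj_on h (W <+> W)"
    by (rule bij_betw_imp_inj_on)
  have "uncountable (h ` Inl ` W)"
    using assms countable_image_inj_on[of h "Inl ` W"] countable_image_inj_on[of Inl W]
      inj_on_subset[OF inj, of "Inl ` W"] by auto
  moreover have "uncountable (h ` Inr ` W)"
    using assms countable_image_inj_on[of h "Inr ` W"] countable_image_inj_on[of Inr W]
      inj_on_subset[OF inj, of "Inr ` W"] by auto
  moreover have "h ` Inl ` W \<inter> h ` Inr ` W = {}"
    using inj by (auto simp: inj_on_def)
  moreover have "h ` Inl ` W \<subseteq> W" "h ` Inr ` W \<subseteq> W"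
    using bij_betw_imp_surj_on[OF h] by auto
  ultimately show ?thesis by blast
qed

end

text \<open>The combinatorial core. Vectors over the field with two elements are replaced by their
  supports, so \<open>N\<close> plays the role of the group and the sum of disjointly supported
  vectors becomes a union. Hypothesis \<open>cpt\<close> is pointwise compactness, applied to the
  cover of \<open>K\<close> by the neighbourhoods \<open>{g. g (X f) = f (X f)}\<close> of its
  members \<open>f\<close>.\<close>

lemma compact_family_countable_support:
  fixes N :: "'i set set" and K :: "('i set \<Rightarrow> complex) set"
  assumes sub: "\<And>X Y. X \<in> N \<Longrightarrow> Y \<subseteq> X \<Longrightarrow> Y \<in> N"
    and prime: "\<And>X Y. X \<inter> Y = {} \<Longrightarrow> X \<in> N \<or> Y \<in> N"
    and sgn: "\<And>f X. f \<in> K \<Longrightarrow> X \<in> N \<Longrightarrow> f X = 1 \<or> f X = -1"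
    and add: "\<And>f X Y. f \<in> K \<Longrightarrow> X \<union> Y \<in> N \<Longrightarrow> X \<inter> Y = {} \<Longrightarrow> f (X \<union> Y) = f X * f Y"
    and csupp: "\<And>f. f \<in> K \<Longrightarrow> \<exists>A. countable A \<and> (\<forall>X\<in>N. X \<inter> A = {} \<longrightarrow> f X = 1)"
    and cpt: "\<And>X. (\<And>f. f \<in> K \<Longrightarrow> X f \<in> N) \<Longrightarrow>
      \<exists>F. finite F \<and> F \<subseteq> K \<and> (\<forall>g\<in>K. \<exists>f\<in>F. g (X f) = f (X f))"
  shows "\<exists>A. countable A \<and> (\<forall>f\<in>K. \<forall>X\<in>N. X \<inter> A = {} \<longrightarrow> f X = 1)"
proof (rule ccontr)
  assume neg: "\<not> ?thesis"
  obtain A where Acount: "\<And>f. f \<in> K \<Longrightarrow> countable (A f)"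
    and A1: "\<And>f X. f \<in> K \<Longrightarrow> X \<in> N \<Longrightarrow> X \<inter> A f = {} \<Longrightarrow> f X = 1"
    using csupp by metis
  obtain W :: "nat set set" and r where wf: "wf r" and tot: "total_on W r"
    and unc: "uncountable W" and seg: "\<And>a. countable {b. (b, a) \<in> r}"
    using ex_uncountable_order_countable_segments by blast
  \<comment> \<open>Stage \<open>a\<close> of the recursion picks a functional \<open>f\<close> and
    a set \<open>X\<close> inside \<open>A f\<close> that avoids the supports of all functionals
    picked earlier. The earlier functionals are therefore \<open>1\<close> on \<open>X\<close>,
    while \<open>f\<close> is \<open>-1\<close> there.\<close>
  define P :: "(nat set \<Rightarrow> ('i set \<Rightarrow> complex) \<times> 'i set) \<Rightarrow> nat set \<Rightarrow>
      ('i set \<Rightarrow> complex) \<times> 'i set \<Rightarrow> bool" where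
    "P = (\<lambda>g a (f, X). f \<in> K \<and> X \<in> N \<and> X \<subseteq> A f - (\<Union>b\<in>{b. (b, a) \<in> r}. A (fst (g b))) \<and> f X = -1)"
  have "\<exists>g. \<forall>a. P g a (g a)"
  proof (rule dependent_wf_choice[OF wf])
    fix g h :: "nat set \<Rightarrow> ('i set \<Rightarrow> complex) \<times> 'i set" and a p
    assume "\<And>z. (z, a) \<in> r \<Longrightarrow> g z = h z"
    then have "(\<Union>b\<in>{b. (b, a) \<in> r}. A (fst (g b))) = (\<Union>b\<in>{b. (b, a) \<in> r}. A (fst (h b)))"
      by auto
    then show "P g a p = P h a p"
      by (simp add: P_def)
  next
    fix a g
    assume IH: "\<And>b. (b, a) \<in> r \<Longrightarrow> P g b (g b)"
    define B where "B = (\<Union>b\<in>{b. (b, a) \<in> r}. A (fst (g b)))"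
    have "countable B"
      unfolding B_def
    proof (rule countable_UN[OF seg])
      fix b assume "b \<in> {b. (b, a) \<in> r}"
      then show "countable (A (fst (g b)))"
        using IH[of b] by (intro Acount) (auto simp: P_def split: prod.splits)
    qed
    then obtain f X where f: "f \<in> K" "X \<in> N" "X \<inter> B = {}" "f X \<noteq> 1"
      using neg by blast
    \<comment> \<open>The part of \<open>X\<close> outside \<open>A f\<close> contributes only the
      factor \<open>1\<close>, so cutting \<open>X\<close> down to \<open>A f\<close> keeps the
      value \<open>-1\<close>.\<close>
    have "f X = f (X \<inter> A f) * f (X - A f)"
      using add[of f "X \<inter> A f" "X - A f"] f by (simp add: Int_Diff_Un Int_Diff_disjoint)
    moreover have "f (X - A f) = 1"
      by (rule A1) (use f sub in auto)
    ultimately have "f (X \<inter> A f) = -1"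
      using sgn[OF f(1,2)] f(4) by auto
    then have "P g a (f, X \<inter> A f)"
      using f sub[of X "X \<inter> A f"] unfolding P_def B_def by auto
    then show "\<exists>p. P g a p" ..
  qed
  then obtain g where g: "\<And>a. P g a (g a)" by blast
  define f where "f a = fst (g a)" for a
  define X where "X a = snd (g a)" for a
  have fK: "f a \<in> K" and XN: "X a \<in> N" and XA: "X a \<subseteq> A (f a)" and fX: "f a (X a) = -1" for a
    using g[of a] by (auto simp: P_def f_def X_def split: prod.splits)
  have Xlt: "X a \<inter> A (f b) = {}" if "(b, a) \<in> r" for a b
    using g[of a] that by (auto simp: P_def f_def X_def split: prod.splits)
  have Xdisj: "X a \<inter> X b = {}" if "a \<in> W" "b \<in> W" "a \<noteq> b" for a b
    using tot that Xlt XA unfolding total_on_def by blast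
  obtain C where C: "C \<subseteq> W" "uncountable C" "\<Union>(X ` C) \<in> N"
  proof -
    obtain C D where CD: "C \<subseteq> W" "D \<subseteq> W" "C \<inter> D = {}" "uncountable C" "uncountable D"
      using uncountable_split[OF unc] by blast
    have "\<Union>(X ` C) \<inter> \<Union>(X ` D) = {}"
      using Xdisj CD by blast
    then show thesis
      using prime that CD by blast
  qed
  have XS: "\<Union>(X ` S) \<in> N" if "S \<subseteq> C" for S
    by (rule sub[OF C(3)]) (use that in blast)
  have solve: "\<exists>S\<subseteq>C'. \<forall>b\<in>C'. f b (\<Union>(X ` S)) = -1" if C': "C' \<subseteq> C" for C'
  proof -
    \<comment> \<open>A triangular system is solved by recursion: \<open>s b\<close> decides whether
      \<open>X b\<close> joins the union. If the sets chosen before \<open>b\<close> already give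
      \<open>f b\<close> the value \<open>-1\<close>, then \<open>X b\<close> is left out; otherwise
      it is added and flips the value.\<close>
    define Q where "Q s b t \<longleftrightarrow> (b \<in> C' \<longrightarrow>
      f b (\<Union>(X ` {a\<in>C'. (a, b) \<in> r \<and> s a}) \<union> (if t then X b else {})) = -1)" for s b t
    have "\<exists>s. \<forall>b. Q s b (s b)"
    proof (rule dependent_wf_choice[OF wf])
      fix s s' :: "nat set \<Rightarrow> bool" and b t
      assume "\<And>z. (z, b) \<in> r \<Longrightarrow> s z = s' z"
      then have "{a\<in>C'. (a, b) \<in> r \<and> s a} = {a\<in>C'. (a, b) \<in> r \<and> s' a}"
        by auto
      then show "Q s b t = Q s' b t"
        by (simp add: Q_def)
    next
      fix b s
      define Y where "Y = \<Union>(X ` {a\<in>C'. (a, b) \<in> r \<and> s a})"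
      show "\<exists>t. Q s b t"
      proof (cases "b \<in> C' \<and> f b Y \<noteq> -1")
        case True
        then have b: "b \<in> C'" by simp
        have "Y \<in> N"
          unfolding Y_def using C' by (intro XS) auto
        then have "f b Y = 1"
          using sgn[OF fK] True by blast
        moreover have "Y \<union> X b \<in> N"
          by (rule sub[OF C(3)]) (use b C' in \<open>auto simp: Y_def\<close>)
        moreover have "Y \<inter> X b = {}"
        proof -
          have "a \<noteq> b" if "(a, b) \<in> r" for a
            using wf that by auto
          then show ?thesis
            unfolding Y_def using Xdisj b C' C(1) by blast
        qed
        ultimately have "f b (Y \<union> X b) = -1"
          using add[OF fK] fX by simp
        then have "Q s b True"
          by (simp add: Q_def Y_def)
        then show ?thesis ..
      next
        case False
        then have "Q s b False"
          by (auto simp: Q_def Y_def)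
        then show ?thesis ..
      qed
    qed
    then obtain s where s: "\<And>b. Q s b (s b)" by blast
    define S where "S = {a\<in>C'. s a}"
    have "f b (\<Union>(X ` S)) = -1" if b: "b \<in> C'" for b
    proof -
      \<comment> \<open>\<open>Y\<close> collects the choices up to and including \<open>b\<close>.
        The remainder \<open>Z\<close> is covered by later sets, which avoid \<open>A (f b)\<close>,
        so it contributes the factor \<open>1\<close>.\<close>
      define Y where "Y = \<Union>(X ` {a\<in>C'. (a, b) \<in> r \<and> s a}) \<union> (if s b then X b else {})"
      define Z where "Z = \<Union>(X ` S) - Y"
      have "f b Y = -1"
        using s[of b] b by (simp add: Q_def Y_def)
      moreover have YS: "Y \<subseteq> \<Union>(X ` S)"
        using b by (auto simp: Y_def S_def)
      moreover have "Z \<in> N"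
        by (rule sub[OF XS[of S]]) (use C' in \<open>auto simp: Z_def S_def\<close>)
      moreover have "Z \<inter> A (f b) = {}"
      proof -
        have "Z \<subseteq> \<Union>(X ` {a. (b, a) \<in> r})"
        proof
          fix i assume "i \<in> Z"
          then obtain a where a: "a \<in> C'" "s a" "i \<in> X a" "i \<notin> Y"
            by (auto simp: Z_def S_def)
          then have "(a, b) \<notin> r" "a \<noteq> b"
            using a by (auto simp: Y_def)
          then have "(b, a) \<in> r"
            using tot a b C' C(1) by (auto simp: total_on_def)
          then show "i \<in> \<Union>(X ` {a. (b, a) \<in> r})"
            using a by auto
        qed
        then show ?thesis
          using Xlt by blast
      qed
      ultimately have "f b (Y \<union> Z) = -1"
        using add[OF fK, of Y Z b] A1[OF fK, of Z b] XS[of S] C'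
        by (simp add: Z_def S_def Un_absorb1 subset_iff)
      then show ?thesis
        using YS by (simp add: Z_def Un_absorb1)
    qed
    then show ?thesis
      by (intro exI[of _ S]) (auto simp: S_def)
  qed
  define D where "D h = {a\<in>C. X a \<inter> A h \<noteq> {}}" for h
  have Dcount: "countable (D h)" if h: "h \<in> K" for h
  proof -
    have "\<forall>a\<in>D h. \<exists>i. i \<in> X a \<inter> A h"
      by (auto simp: D_def)
    then obtain p where p: "\<And>a. a \<in> D h \<Longrightarrow> p a \<in> X a \<inter> A h"
      by metis
    \<comment> \<open>The sets \<open>X a\<close> are pairwise disjoint, so distinct indices receive
      distinct points of the countable set \<open>A h\<close>.\<close>
    have "inj_on p (D h)"
    proof (rule inj_onI, rule ccontr)
      fix a b assume ab: "a \<in> D h" "b \<in> D h" "p a = p b" "a \<noteq> b"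
      then have "X a \<inter> X b = {}"
        using C(1) by (intro Xdisj) (auto simp: D_def)
      then show False
        using p[OF ab(1)] p[OF ab(2)] ab(3) by auto
    qed
    moreover have "countable (p ` D h)"
      by (rule countable_subset[OF _ Acount[OF h]]) (use p in auto)
    ultimately show ?thesis
      using countable_image_inj_on by blast
  qed
  have "\<forall>h. \<exists>S\<subseteq>C - D h. \<forall>b\<in>C - D h. f b (\<Union>(X ` S)) = -1"
    using solve by blast
  then obtain S where S: "\<And>h. S h \<subseteq> C - D h"
    and SX: "\<And>h b. b \<in> C - D h \<Longrightarrow> f b (\<Union>(X ` S h)) = -1"
    by metis
  have SN: "\<Union>(X ` S h) \<in> N" for h
    using S by (intro XS) blast
  \<comment> \<open>The test set attached to \<open>h\<close> is the union of the sets indexed by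
    \<open>S h\<close>. It misses \<open>A h\<close>, so \<open>h\<close> has value \<open>1\<close>
    on it, whereas \<open>f b\<close> has value \<open>-1\<close> for every \<open>b\<close> in
    \<open>C - D h\<close>. Thus \<open>f b\<close> can agree with \<open>h\<close> there only for
    \<open>b\<close> in \<open>D h\<close>, and finitely many such countable sets would cover
    \<open>C\<close>.\<close>
  have "\<exists>F. finite F \<and> F \<subseteq> K \<and> (\<forall>g\<in>K. \<exists>h\<in>F. g (\<Union>(X ` S h)) = h (\<Union>(X ` S h)))"
    by (rule cpt) (rule SN)
  then obtain F where F: "finite F" "F \<subseteq> K"
    and cover: "\<And>g. g \<in> K \<Longrightarrow> \<exists>h\<in>F. g (\<Union>(X ` S h)) = h (\<Union>(X ` S h))"
    by metis
  have "C \<subseteq> (\<Union>h\<in>F. D h)"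
  proof
    fix b assume b: "b \<in> C"
    obtain h where h: "h \<in> F" "f b (\<Union>(X ` S h)) = h (\<Union>(X ` S h))"
      using cover[OF fK] by metis
    have "\<Union>(X ` S h) \<inter> A h = {}"
      using S[of h] by (auto simp: D_def)
    then have "h (\<Union>(X ` S h)) = 1"
      using h(1) F(2) SN by (intro A1) auto
    then have "b \<in> D h"
      using SX[of b h] b h by force
    then show "b \<in> (\<Union>h\<in>F. D h)"
      using h by blast
  qed
  moreover have "countable (\<Union>h\<in>F. D h)"
    using F Dcount by (intro countable_UN) (auto intro: countable_finite)
  ultimately show False
    using C(2) countable_subset by blast
qed

section \<open>The topology of countable agreement\<close>

text \<open>A basic box restricts only finitely many coordinates, and over a discrete factor each
  restricted side can be shrunk to a point.\<close>

lemma openin_product_discrete: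
  "openin (product_topology (\<lambda>_. discrete_topology D) I) U \<longleftrightarrow>
    U \<subseteq> (\<Pi>\<^sub>E i\<in>I. D) \<and>
    (\<forall>x\<in>U. \<exists>F. finite F \<and> F \<subseteq> I \<and> (\<forall>y\<in>\<Pi>\<^sub>E i\<in>I. D. (\<forall>i\<in>F. y i = x i) \<longrightarrow> y \<in> U))"
  (is "?L \<longleftrightarrow> ?R")
proof
  assume L: ?L
  have "\<exists>F. finite F \<and> F \<subseteq> I \<and> (\<forall>y\<in>\<Pi>\<^sub>E i\<in>I. D. (\<forall>i\<in>F. y i = x i) \<longrightarrow> y \<in> U)" if "x \<in> U" for x
  proof -
    obtain V where V: "finite {i \<in> I. V i \<noteq> D}" "x \<in> Pi\<^sub>E I V" "Pi\<^sub>E I V \<subseteq> U"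
      using L \<open>x \<in> U\<close> unfolding openin_product_topology_alt by fastforce
    have "y \<in> U" if y: "y \<in> (\<Pi>\<^sub>E i\<in>I. D)" "\<forall>i\<in>{i \<in> I. V i \<noteq> D}. y i = x i" for y
    proof -
      have "y i \<in> V i" if "i \<in> I" for i
        using y V(2) that by (cases "V i = D") (auto simp: PiE_iff)
      then show ?thesis
        using y(1) by (intro subsetD[OF V(3)] PiE_I) (auto simp: PiE_iff extensional_def)
    qed
    then show ?thesis
      using V(1) by (intro exI[of _ "{i \<in> I. V i \<noteq> D}"]) auto
  qed
  then show ?R
    using openin_subset[OF L] by auto
next
  assume R: ?R
  show ?L
    unfolding openin_product_topology_alt
  proof
    fix x assume "x \<in> U"
    then obtain F where F: "finite F" "F \<subseteq> I" "\<forall>y\<in>\<Pi>\<^sub>E i\<in>I. D. (\<forall>i\<in>F. y i = x i) \<longrightarrow> y \<in> U"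
      using R by blast
    have x: "x \<in> (\<Pi>\<^sub>E i\<in>I. D)"
      using R \<open>x \<in> U\<close> by blast
    define V where "V i = (if i \<in> F then {x i} else D)" for i
    have V: "V i \<subseteq> D" if "i \<in> I" for i
      using x that by (auto simp: V_def PiE_iff)
    have "Pi\<^sub>E I V \<subseteq> U"
    proof
      fix y assume y: "y \<in> Pi\<^sub>E I V"
      then have "y \<in> (\<Pi>\<^sub>E i\<in>I. D)"
        using V by (auto simp: PiE_iff)
      moreover have "\<forall>i\<in>F. y i = x i"
        using y F(2) by (auto simp: PiE_iff V_def dest: bspec)
      ultimately show "y \<in> U"
        using F(3) by blast
    qed
    moreover have "x \<in> Pi\<^sub>E I V"
      using x by (auto simp: PiE_iff V_def)
    moreover have "finite {i \<in> I. V i \<noteq> D}"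
      by (rule finite_subset[OF _ F(1)]) (auto simp: V_def)
    ultimately show "\<exists>V. finite {i \<in> I. V i \<noteq> topspace (discrete_topology D)} \<and>
        (\<forall>i\<in>I. openin (discrete_topology D) (V i)) \<and> x \<in> Pi\<^sub>E I V \<and> Pi\<^sub>E I V \<subseteq> U"
      using V by (intro exI[of _ V]) auto
  qed
qed

lemma gdelta_inE:
  assumes "gdelta_in X S"
  obtains \<V> where "countable \<V>" "\<And>V. V \<in> \<V> \<Longrightarrow> openin X V" "S = \<Inter>\<V>"
proof -
  obtain \<V> where \<V>: "countable \<V>" "\<V> \<subseteq> Collect (openin X)" "\<Inter>\<V> = S"
    using assms unfolding gdelta_in_alt intersection_of_def by blast
  show thesis
    by (rule that[of \<V>]) (use \<V> in auto)
qed

text \<open>A countable intersection of open sets involves countably many finite sets of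
  coordinates, hence one countable set. Conversely, fixing countably many coordinates is a countable
  intersection of open one-coordinate conditions.\<close>

lemma openin_P_modification_product_discrete:
  "openin (P_modification (product_topology (\<lambda>_. discrete_topology D) I)) U \<longleftrightarrow>
    U \<subseteq> (\<Pi>\<^sub>E i\<in>I. D) \<and>
    (\<forall>x\<in>U. \<exists>A. countable A \<and> A \<subseteq> I \<and> (\<forall>y\<in>\<Pi>\<^sub>E i\<in>I. D. (\<forall>i\<in>A. y i = x i) \<longrightarrow> y \<in> U))"
  (is "openin (P_modification ?X) U \<longleftrightarrow> ?R")
proof
  assume L: "openin (P_modification ?X) U"
  have "\<exists>A. countable A \<and> A \<subseteq> I \<and> (\<forall>y\<in>\<Pi>\<^sub>E i\<in>I. D. (\<forall>i\<in>A. y i = x i) \<longrightarrow> y \<in> U)" if "x \<in> U" for x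
  proof -
    obtain S where S: "gdelta_in ?X S" "x \<in> S" "S \<subseteq> U"
      using L \<open>x \<in> U\<close> unfolding openin_P_modification by (auto simp: union_of_def)
    obtain \<V> where \<V>: "countable \<V>" "\<And>V. V \<in> \<V> \<Longrightarrow> openin ?X V" "S = \<Inter>\<V>"
      using gdelta_inE[OF S(1)] by metis
    have "\<forall>V\<in>\<V>. \<exists>F. finite F \<and> F \<subseteq> I \<and> (\<forall>y\<in>\<Pi>\<^sub>E i\<in>I. D. (\<forall>i\<in>F. y i = x i) \<longrightarrow> y \<in> V)"
    proof
      fix V assume "V \<in> \<V>"
      then have "openin ?X V" "x \<in> V"
        using \<V>(2,3) S(2) by auto
      then show "\<exists>F. finite F \<and> F \<subseteq> I \<and> (\<forall>y\<in>\<Pi>\<^sub>E i\<in>I. D. (\<forall>i\<in>F. y i = x i) \<longrightarrow> y \<in> V)"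
        unfolding openin_product_discrete by simp
    qed
    then obtain F where F: "\<And>V. V \<in> \<V> \<Longrightarrow> finite (F V)" "\<And>V. V \<in> \<V> \<Longrightarrow> F V \<subseteq> I"
      "\<And>V y. V \<in> \<V> \<Longrightarrow> y \<in> (\<Pi>\<^sub>E i\<in>I. D) \<Longrightarrow> (\<forall>i\<in>F V. y i = x i) \<Longrightarrow> y \<in> V"
      by metis
    have "countable (\<Union>V\<in>\<V>. F V)"
      using \<V>(1) F(1) by (intro countable_UN) (auto intro: countable_finite)
    moreover have "(\<Union>V\<in>\<V>. F V) \<subseteq> I"
      using F(2) by blast
    moreover have "y \<in> U" if "y \<in> (\<Pi>\<^sub>E i\<in>I. D)" "\<forall>i\<in>(\<Union>V\<in>\<V>. F V). y i = x i" for y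
    proof -
      have "y \<in> S"
        unfolding \<V>(3) using F(3) that by blast
      then show ?thesis
        using S(3) by blast
    qed
    ultimately show ?thesis
      by (intro exI[of _ "\<Union>V\<in>\<V>. F V"]) simp
  qed
  then show ?R
    using openin_subset[OF L] by auto
next
  assume R: ?R
  show "openin (P_modification ?X) U"
  proof (subst openin_subopen, intro ballI)
    fix x assume "x \<in> U"
    then obtain A where A: "countable A" "A \<subseteq> I"
      "\<forall>y\<in>\<Pi>\<^sub>E i\<in>I. D. (\<forall>i\<in>A. y i = x i) \<longrightarrow> y \<in> U"
      using R by blast
    define C where "C i = {y \<in> (\<Pi>\<^sub>E i\<in>I. D). y i = x i}" for i
    have "openin ?X (C i)" if "i \<in> A" for i
      unfolding openin_product_discrete C_def using A(2) that
      by (auto intro!: exI[of _ "{i}"])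
    \<comment> \<open>The whole space is inserted to cover the case of empty \<open>A\<close>, where
      the bare intersection would be \<open>UNIV\<close>.\<close>
    then have "gdelta_in ?X (\<Inter>(insert (topspace ?X) (C ` A)))"
      using A(1) gdelta_in_topspace[of ?X] by (intro gdelta_in_Inter) (auto intro: open_imp_gdelta_in)
    then have "openin (P_modification ?X) (\<Inter>(insert (topspace ?X) (C ` A)))"
      unfolding openin_P_modification by (rule arbitrary_union_of_inc)
    moreover have "x \<in> \<Inter>(insert (topspace ?X) (C ` A))"
      using R \<open>x \<in> U\<close> by (auto simp: C_def)
    moreover have "\<Inter>(insert (topspace ?X) (C ` A)) \<subseteq> U"
      using A(3) by (auto simp: C_def)
    ultimately show "\<exists>V. openin (P_modification ?X) V \<and> x \<in> V \<and> V \<subseteq> U"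
      by blast
  qed
qed

text \<open>If neither set belongs to \<open>\<xi>\<close>, the sets \<open>Z\<close> with
  \<open>X \<union> Z \<in> \<xi>\<close> form a filter extending \<open>\<xi>\<close>. By
  maximality it is \<open>\<xi>\<close> itself, yet it contains \<open>Y\<close>.\<close>

lemma ultrafilter_on_prime:
  assumes "ultrafilter_on I \<xi>" and "X \<subseteq> I" "Y \<subseteq> I" "X \<union> Y \<in> \<xi>"
  shows "X \<in> \<xi> \<or> Y \<in> \<xi>"
proof (rule ccontr)
  assume neg: "\<not> ?thesis"
  have fil: "filter_on I \<xi>" and max: "\<And>F. filter_on I F \<Longrightarrow> \<xi> \<subseteq> F \<Longrightarrow> F = \<xi>"
    using assms(1) by (auto simp: ultrafilter_on_def)
  then have up: "B \<in> \<xi>" if "A \<in> \<xi>" "A \<subseteq> B" "B \<subseteq> I" for A B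
    using that by (auto simp: filter_on_def)
  have int: "A \<inter> B \<in> \<xi>" if "A \<in> \<xi>" "B \<in> \<xi>" for A B
    using fil that by (auto simp: filter_on_def)
  define F where "F = {Z. Z \<subseteq> I \<and> X \<union> Z \<in> \<xi>}"
  have "filter_on I F"
    unfolding filter_on_def
  proof (intro conjI ballI allI impI)
    show "I \<in> F"
      using fil assms(2) by (auto simp: F_def filter_on_def Un_absorb1)
    show "A \<inter> B \<in> F" if "A \<in> F" "B \<in> F" for A B
      using int[of "X \<union> A" "X \<union> B"] that by (auto simp: F_def Un_Int_distrib)
    show "B \<in> F" if "A \<in> F" "A \<subseteq> B \<and> B \<subseteq> I" for A B
      using up[of "X \<union> A" "X \<union> B"] that assms(2) by (auto simp: F_def)
  qed (use neg in \<open>auto simp: F_def\<close>)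
  moreover have "\<xi> \<subseteq> F"
    using fil up assms(2) by (auto simp: F_def filter_on_def)
  ultimately have "F = \<xi>"
    by (rule max)
  then show False
    using neg assms by (auto simp: F_def)
qed

section \<open>The group and its topology\<close>

locale ultrafilter_subgroup =
  fixes \<tau> :: "'i set" and \<xi> :: "'i set set"
  assumes uncountable: "uncountable \<tau>"
    and ultrafilter: "ultrafilter_on \<tau> \<xi>"
    and cocountable: "\<And>C. C \<subseteq> \<tau> \<Longrightarrow> countable C \<Longrightarrow> \<tau> - C \<in> \<xi>"
begin

abbreviation "G \<equiv> G_group \<tau> \<xi>"
abbreviation "T \<equiv> G_topology \<tau> \<xi>"
abbreviation "H \<equiv> dual_group G T"
abbreviation "TH \<equiv> dual_topology G T"

text \<open>Characteristic functions, through which elements of \<open>G\<close> are handled as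
  sets. Arbitrary sets are allowed; only their points in \<open>\<tau>\<close> count, and the value
  outside \<open>\<tau>\<close> is \<open>undefined\<close>, as extensionality demands.\<close>

definition vec :: "'i set \<Rightarrow> 'i \<Rightarrow> int" where
  "vec X = (\<lambda>i\<in>\<tau>. if i \<in> X then 1 else 0)"

lemma ideal_mono: "X \<notin> \<xi> \<Longrightarrow> Y \<subseteq> X \<Longrightarrow> X \<subseteq> \<tau> \<Longrightarrow> Y \<notin> \<xi>"
  using ultrafilter by (auto simp: ultrafilter_on_def filter_on_def)

lemma ideal_Un: "X \<notin> \<xi> \<Longrightarrow> Y \<notin> \<xi> \<Longrightarrow> X \<subseteq> \<tau> \<Longrightarrow> Y \<subseteq> \<tau> \<Longrightarrow> X \<union> Y \<notin> \<xi>"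
  using ultrafilter_on_prime[OF ultrafilter] by blast

lemma disjoint_not_both:
  assumes "X \<inter> Y = {}" shows "X \<notin> \<xi> \<or> Y \<notin> \<xi>"
proof -
  have "X \<inter> Y \<in> \<xi>" if "X \<in> \<xi>" "Y \<in> \<xi>"
    using ultrafilter that by (simp add: ultrafilter_on_def filter_on_def)
  moreover have "{} \<notin> \<xi>"
    using ultrafilter by (simp add: ultrafilter_on_def filter_on_def)
  ultimately show ?thesis
    using assms by auto
qed

lemma countable_in_ideal:
  assumes "countable C" "C \<subseteq> \<tau>" shows "C \<notin> \<xi>"
  using disjoint_not_both[of C "\<tau> - C"] cocountable[OF assms(2,1)] by auto

section \<open>Elements and operations of the group in coordinates\<close>

lemma carrier_Z2_power: "carrier (Z2_power \<tau>) = (\<Pi>\<^sub>E i\<in>\<tau>. {0, 1})"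
proof -
  have "{0..<2} = {0, 1 :: int}" by auto
  then show ?thesis by (simp add: Z2_power_def carrier_integer_mod_group)
qed

lemma carrier_G: "carrier G = {x \<in> \<Pi>\<^sub>E i\<in>\<tau>. {0, 1}. {i\<in>\<tau>. x i \<noteq> 0} \<notin> \<xi>}"
  by (simp add: G_group_def G_sub_def carrier_Z2_power supp_def)

lemma mult_G: "x \<otimes>\<^bsub>G\<^esub> y = (\<lambda>i\<in>\<tau>. (x i + y i) mod 2)"
  by (simp add: G_group_def Z2_power_def)

lemma one_G: "\<one>\<^bsub>G\<^esub> = (\<lambda>i\<in>\<tau>. 0)"
  by (simp add: G_group_def Z2_power_def)

lemma G_range: "x \<in> carrier G \<Longrightarrow> i \<in> \<tau> \<Longrightarrow> x i = 0 \<or> x i = 1"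
  by (auto simp: carrier_G PiE_iff)

lemma G_ext: "x \<in> carrier G \<Longrightarrow> y \<in> carrier G \<Longrightarrow> (\<And>i. i \<in> \<tau> \<Longrightarrow> x i = y i) \<Longrightarrow> x = y"
  by (rule extensionalityI[of x \<tau> y]) (auto simp: carrier_G PiE_iff)

lemma vec_in_G: "vec X \<in> carrier G \<longleftrightarrow> X \<inter> \<tau> \<notin> \<xi>"
proof -
  have "{i\<in>\<tau>. vec X i \<noteq> 0} = X \<inter> \<tau>"
    by (auto simp: vec_def)
  then show ?thesis
    by (auto simp: carrier_G vec_def)
qed

lemma G_eq_vec: "x \<in> carrier G \<Longrightarrow> x = vec {i\<in>\<tau>. x i \<noteq> 0}"
proof (rule G_ext)
  assume x: "x \<in> carrier G"
  have "{i\<in>\<tau>. x i \<noteq> 0} \<inter> \<tau> = {i\<in>\<tau>. x i \<noteq> 0}" by auto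
  then show "vec {i\<in>\<tau>. x i \<noteq> 0} \<in> carrier G"
    using x unfolding vec_in_G by (simp add: carrier_G)
  show "x i = vec {i\<in>\<tau>. x i \<noteq> 0} i" if "i \<in> \<tau>" for i
    using G_range[OF x that] that by (auto simp: vec_def)
qed

text \<open>Each element is its own inverse, and the support of a sum lies in the union of the two
  supports, which stays outside \<open>\<xi>\<close> because an ultrafilter is prime.\<close>

lemma subgroup_G: "subgroup (G_sub \<tau> \<xi>) (Z2_power \<tau>)"
proof -
  interpret Z: group "Z2_power \<tau>"
    by (simp add: Z2_power_def)
  have inv: "inv\<^bsub>Z2_power \<tau>\<^esub> x = x" if "x \<in> carrier (Z2_power \<tau>)" for x
  proof (rule Z.inv_equality)
    show "x \<otimes>\<^bsub>Z2_power \<tau>\<^esub> x = \<one>\<^bsub>Z2_power \<tau>\<^esub>"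
      by (auto simp: Z2_power_def)
  qed (use that in auto)
  show ?thesis
  proof (rule Z.subgroupI)
    show "G_sub \<tau> \<xi> \<subseteq> carrier (Z2_power \<tau>)"
      by (auto simp: G_sub_def)
    have "vec {} \<in> carrier G"
      using countable_in_ideal[of "{}"] by (simp add: vec_in_G)
    then show "G_sub \<tau> \<xi> \<noteq> {}"
      by (auto simp: G_group_def)
    show "inv\<^bsub>Z2_power \<tau>\<^esub> x \<in> G_sub \<tau> \<xi>" if "x \<in> G_sub \<tau> \<xi>" for x
      using that by (simp add: G_sub_def inv)
    show "x \<otimes>\<^bsub>Z2_power \<tau>\<^esub> y \<in> G_sub \<tau> \<xi>" if "x \<in> G_sub \<tau> \<xi>" "y \<in> G_sub \<tau> \<xi>" for x y
    proof -
      have "supp \<tau> x \<union> supp \<tau> y \<notin> \<xi>"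
        using that by (intro ideal_Un) (auto simp: G_sub_def supp_def)
      moreover have "supp \<tau> (x \<otimes>\<^bsub>Z2_power \<tau>\<^esub> y) \<subseteq> supp \<tau> x \<union> supp \<tau> y"
        by (auto simp: supp_def Z2_power_def)
      ultimately have "supp \<tau> (x \<otimes>\<^bsub>Z2_power \<tau>\<^esub> y) \<notin> \<xi>"
        by (rule ideal_mono) (auto simp: supp_def)
      then show ?thesis
        using that by (simp add: G_sub_def)
    qed
  qed
qed

lemma group_G: "group G"
  unfolding G_group_def
  by (rule subgroup.subgroup_is_group[OF subgroup_G]) (simp add: Z2_power_def)

lemma comm_group_G: "comm_group G"
  by (rule group.group_comm_groupI[OF group_G]) (simp add: mult_G add.commute)

lemma mult_in_G: "x \<in> carrier G \<Longrightarrow> y \<in> carrier G \<Longrightarrow> x \<otimes>\<^bsub>G\<^esub> y \<in> carrier G"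
  using group_G by (simp add: group.is_monoid monoid.m_closed)

lemma one_in_G: "\<one>\<^bsub>G\<^esub> \<in> carrier G"
  using group_G by (simp add: group.is_monoid)

lemma mult_self_G: "x \<otimes>\<^bsub>G\<^esub> x = \<one>\<^bsub>G\<^esub>"
  by (auto simp: mult_G one_G)

lemma inv_G: "x \<in> carrier G \<Longrightarrow> inv\<^bsub>G\<^esub> x = x"
  by (rule group.inv_equality[OF group_G mult_self_G])

text \<open>The \<open>P\<close>-modification and the passage to the subgroup are absorbed here:
  open sets are described by agreement on countable sets of coordinates.\<close>

lemma openin_G:
  "openin T U \<longleftrightarrow> U \<subseteq> carrier G \<and>
    (\<forall>x\<in>U. \<exists>A. countable A \<and> A \<subseteq> \<tau> \<and> (\<forall>y\<in>carrier G. (\<forall>i\<in>A. y i = x i) \<longrightarrow> y \<in> U))"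
  (is "?L \<longleftrightarrow> ?R")
proof
  let ?D = "carrier (integer_mod_group 2)"
  have D: "?D = {0, 1}"
    by (auto simp: carrier_integer_mod_group)
  have T: "T = subtopology (P_modification (product_topology (\<lambda>_. discrete_topology {0, 1}) \<tau>)) (carrier G)"
    by (simp add: G_topology_def Z2_power_topology_def D G_group_def)
  {
    assume ?L
    then obtain V where V: "openin (P_modification (product_topology (\<lambda>_. discrete_topology {0, 1}) \<tau>)) V"
      and U: "U = V \<inter> carrier G"
      unfolding T openin_subtopology by blast
    show ?R
    proof (intro conjI ballI)
      fix x assume "x \<in> U"
      then obtain A where A: "countable A" "A \<subseteq> \<tau>" "\<forall>y\<in>\<Pi>\<^sub>E i\<in>\<tau>. {0, 1}. (\<forall>i\<in>A. y i = x i) \<longrightarrow> y \<in> V"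
        using V U unfolding openin_P_modification_product_discrete by blast
      then have "\<forall>y\<in>carrier G. (\<forall>i\<in>A. y i = x i) \<longrightarrow> y \<in> U"
        unfolding U by (auto simp: carrier_G)
      then show "\<exists>A. countable A \<and> A \<subseteq> \<tau> \<and> (\<forall>y\<in>carrier G. (\<forall>i\<in>A. y i = x i) \<longrightarrow> y \<in> U)"
        using A by blast
    qed (use U in auto)
  }
  assume R: ?R
  \<comment> \<open>\<open>V\<close> is the union of the corresponding cylinders in the full power.
    Its trace on \<open>G\<close> is \<open>U\<close>, since each of these cylinders meets
    \<open>G\<close> inside \<open>U\<close>.\<close>
  define V where "V = {z \<in> \<Pi>\<^sub>E i\<in>\<tau>. {0, 1}. \<exists>x\<in>U. \<exists>A. countable A \<and> A \<subseteq> \<tau> \<and>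
      (\<forall>y\<in>carrier G. (\<forall>i\<in>A. y i = x i) \<longrightarrow> y \<in> U) \<and> (\<forall>i\<in>A. z i = x i)}"
  have "openin (P_modification (product_topology (\<lambda>_. discrete_topology {0, 1}) \<tau>)) V"
    unfolding openin_P_modification_product_discrete
  proof (intro conjI ballI)
    fix z assume "z \<in> V"
    then obtain x A where xA: "x \<in> U" "countable A" "A \<subseteq> \<tau>"
      "\<forall>y\<in>carrier G. (\<forall>i\<in>A. y i = x i) \<longrightarrow> y \<in> U" "\<forall>i\<in>A. z i = x i"
      unfolding V_def by blast
    then have "\<forall>y\<in>\<Pi>\<^sub>E i\<in>\<tau>. {0, 1}. (\<forall>i\<in>A. y i = z i) \<longrightarrow> y \<in> V"
      unfolding V_def by (smt (verit) mem_Collect_eq)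
    then show "\<exists>A. countable A \<and> A \<subseteq> \<tau> \<and> (\<forall>y\<in>\<Pi>\<^sub>E i\<in>\<tau>. {0, 1}. (\<forall>i\<in>A. y i = z i) \<longrightarrow> y \<in> V)"
      using xA by blast
  qed (auto simp: V_def)
  moreover have "U = V \<inter> carrier G"
  proof
    show "U \<subseteq> V \<inter> carrier G"
    proof
      fix x assume x: "x \<in> U"
      then have "x \<in> carrier G" "\<exists>A. countable A \<and> A \<subseteq> \<tau> \<and> (\<forall>y\<in>carrier G. (\<forall>i\<in>A. y i = x i) \<longrightarrow> y \<in> U)"
        using R by auto
      then show "x \<in> V \<inter> carrier G"
        using x by (auto simp: V_def carrier_G)
    qed
    show "V \<inter> carrier G \<subseteq> U"
      by (auto simp: V_def)
  qed
  ultimately show ?L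
    unfolding T openin_subtopology by blast
qed

lemma topspace_G: "topspace T = carrier G"
proof
  show "topspace T \<subseteq> carrier G"
    using openin_topspace[of T] unfolding openin_G by blast
  have "openin T (carrier G)"
    unfolding openin_G by (auto intro: exI[of _ "{}"])
  then show "carrier G \<subseteq> topspace T"
    by (rule openin_subset)
qed

section \<open>Group topology, \<open>P\<close>-property and nondiscreteness\<close>

lemma openin_cylinder:
  assumes "countable A" "A \<subseteq> \<tau>"
  shows "openin T {y \<in> carrier G. \<forall>i\<in>A. y i = x i}"
  unfolding openin_G using assms by (auto intro!: exI[of _ A])

text \<open>A coordinate of a product depends only on the same coordinate of the factors, so
  cylinders over one common \<open>A\<close> serve both factors. Inversion is the identity
  map.\<close>

lemma topological_group_G: "topological_group G T"
  unfolding topological_group_def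
proof (intro conjI)
  show "continuous_map T T (\<lambda>x. inv\<^bsub>G\<^esub> x)"
    by (rule continuous_map_eq[of T T "\<lambda>x. x"]) (simp_all add: inv_G topspace_G)
  show "continuous_map (prod_topology T T) T (\<lambda>(x, y). x \<otimes>\<^bsub>G\<^esub> y)"
    unfolding continuous_map_def
  proof (intro conjI allI impI)
    show "(\<lambda>(x, y). x \<otimes>\<^bsub>G\<^esub> y) \<in> topspace (prod_topology T T) \<rightarrow> topspace T"
      by (auto simp: topspace_G mult_in_G)
    fix U assume U: "openin T U"
    show "openin (prod_topology T T) {z \<in> topspace (prod_topology T T). (case z of (x, y) \<Rightarrow> x \<otimes>\<^bsub>G\<^esub> y) \<in> U}"
      unfolding openin_prod_topology_alt
    proof (intro allI impI)
      fix x y assume "(x, y) \<in> {z \<in> topspace (prod_topology T T). (case z of (x, y) \<Rightarrow> x \<otimes>\<^bsub>G\<^esub> y) \<in> U}"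
      then have xy: "x \<in> carrier G" "y \<in> carrier G" "x \<otimes>\<^bsub>G\<^esub> y \<in> U"
        by (auto simp: topspace_G)
      then obtain A where A: "countable A" "A \<subseteq> \<tau>"
        "\<forall>z\<in>carrier G. (\<forall>i\<in>A. z i = (x \<otimes>\<^bsub>G\<^esub> y) i) \<longrightarrow> z \<in> U"
        using U unfolding openin_G by blast
      let ?C = "\<lambda>x. {y \<in> carrier G. \<forall>i\<in>A. y i = x i}"
      have "?C x \<times> ?C y \<subseteq> {z \<in> topspace (prod_topology T T). (case z of (x, y) \<Rightarrow> x \<otimes>\<^bsub>G\<^esub> y) \<in> U}"
      proof clarsimp
        fix a b assume ab: "a \<in> carrier G" "\<forall>i\<in>A. a i = x i" "b \<in> carrier G" "\<forall>i\<in>A. b i = y i"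
        then have "a \<otimes>\<^bsub>G\<^esub> b \<in> U"
          using A(2) by (intro A(3)[rule_format] mult_in_G) (auto simp: mult_G)
        then show "a \<in> topspace T \<and> b \<in> topspace T \<and> a \<otimes>\<^bsub>G\<^esub> b \<in> U"
          using ab by (simp add: topspace_G)
      qed
      then show "\<exists>V W. openin T V \<and> openin T W \<and> x \<in> V \<and> y \<in> W \<and>
          V \<times> W \<subseteq> {z \<in> topspace (prod_topology T T). (case z of (x, y) \<Rightarrow> x \<otimes>\<^bsub>G\<^esub> y) \<in> U}"
        using openin_cylinder[OF A(1,2)] xy by (intro exI[of _ "?C x"] exI[of _ "?C y"]) auto
    qed
  qed
qed (simp_all add: group_G topspace_G)

text \<open>Countably many countable sets of coordinates have a countable union, so a countable
  intersection of open sets contains a cylinder around each of its points.\<close>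

lemma P_group_G: "P_group G T"
  unfolding P_group_def
proof (intro conjI allI impI topological_group_G)
  fix S assume S: "gdelta_in T S"
  obtain \<V> where \<V>: "countable \<V>" "\<And>V. V \<in> \<V> \<Longrightarrow> openin T V" "S = \<Inter>\<V>"
    using gdelta_inE[OF S] by metis
  show "openin T S"
    unfolding openin_G
  proof (intro conjI ballI)
    show "S \<subseteq> carrier G"
      using gdelta_in_subset[OF S] by (simp add: topspace_G)
    fix x assume "x \<in> S"
    have "\<forall>V\<in>\<V>. \<exists>A. countable A \<and> A \<subseteq> \<tau> \<and> (\<forall>y\<in>carrier G. (\<forall>i\<in>A. y i = x i) \<longrightarrow> y \<in> V)"
    proof
      fix V assume "V \<in> \<V>"
      then have "openin T V" "x \<in> V"
        using \<V>(2,3) \<open>x \<in> S\<close> by auto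
      then show "\<exists>A. countable A \<and> A \<subseteq> \<tau> \<and> (\<forall>y\<in>carrier G. (\<forall>i\<in>A. y i = x i) \<longrightarrow> y \<in> V)"
        unfolding openin_G by simp
    qed
    then obtain A where A: "\<And>V. V \<in> \<V> \<Longrightarrow> countable (A V)" "\<And>V. V \<in> \<V> \<Longrightarrow> A V \<subseteq> \<tau>"
      "\<And>V y. V \<in> \<V> \<Longrightarrow> y \<in> carrier G \<Longrightarrow> (\<forall>i\<in>A V. y i = x i) \<Longrightarrow> y \<in> V"
      by metis
    then have "countable (\<Union>V\<in>\<V>. A V)" "(\<Union>V\<in>\<V>. A V) \<subseteq> \<tau>"
      using \<V>(1) by auto
    moreover have "\<forall>y\<in>carrier G. (\<forall>i\<in>(\<Union>V\<in>\<V>. A V). y i = x i) \<longrightarrow> y \<in> S"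
      unfolding \<V>(3) using A(3) by blast
    ultimately show "\<exists>A. countable A \<and> A \<subseteq> \<tau> \<and> (\<forall>y\<in>carrier G. (\<forall>i\<in>A. y i = x i) \<longrightarrow> y \<in> S)"
      by blast
  qed
qed

text \<open>A neighbourhood of the neutral element may be taken to control only countably many
  coordinates. Some \<open>i\<close> in the uncountable set \<open>\<tau>\<close> escapes them, and
  \<open>vec {i}\<close> is a second element of that neighbourhood.\<close>

lemma nondiscrete_G: "T \<noteq> discrete_topology (G_sub \<tau> \<xi>)"
proof
  assume eq: "T = discrete_topology (G_sub \<tau> \<xi>)"
  have "openin T {\<one>\<^bsub>G\<^esub>}"
    using one_in_G unfolding eq by (simp add: G_group_def)
  then obtain A where A: "countable A" "A \<subseteq> \<tau>" "\<forall>y\<in>carrier G. (\<forall>i\<in>A. y i = \<one>\<^bsub>G\<^esub> i) \<longrightarrow> y = \<one>\<^bsub>G\<^esub>"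
    unfolding openin_G by auto
  obtain i where i: "i \<in> \<tau>" "i \<notin> A"
    using A(1,2) uncountable countable_subset[of \<tau> A] by blast
  have "vec {i} \<in> carrier G"
    using countable_in_ideal[of "{i}"] i by (simp add: vec_in_G)
  then have "vec {i} = \<one>\<^bsub>G\<^esub>"
    using A i by (auto simp: vec_def one_G)
  then have "vec {i} i = \<one>\<^bsub>G\<^esub> i"
    by simp
  then show False
    using i by (simp add: vec_def one_G)
qed

text \<open>Countably many points of a compact set are separated by countably many coordinates, so
  some open cover by cylinders isolates each of them.\<close>

lemma compactin_G_finite:
  assumes K: "compactin T K" shows "finite K"
proof (rule ccontr)
  assume "infinite K"
  then obtain D where D: "D \<subseteq> K" "countable D" "infinite D"
    using infinite_countable_subset' by (metis countable_subset)
  have KG: "K \<subseteq> carrier G"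
    using compactin_subset_topspace[OF K] by (simp add: topspace_G)
  have "\<exists>i\<in>\<tau>. x i \<noteq> y i" if "x \<in> D" "y \<in> D" "x \<noteq> y" for x y
    using G_ext[of x y] that D KG by blast
  then obtain p where p: "\<And>x y. x \<in> D \<Longrightarrow> y \<in> D \<Longrightarrow> x \<noteq> y \<Longrightarrow> p x y \<in> \<tau> \<and> x (p x y) \<noteq> y (p x y)"
    by metis
  define A where "A = {p x y |x y. x \<in> D \<and> y \<in> D \<and> x \<noteq> y}"
  have "A \<subseteq> (\<lambda>(x, y). p x y) ` (D \<times> D)"
    by (auto simp: A_def)
  moreover have "countable ((\<lambda>(x, y). p x y) ` (D \<times> D))"
    using D(2) by simp
  ultimately have A: "countable A"
    by (rule countable_subset)
  have A': "A \<subseteq> \<tau>"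
    using p by (auto simp: A_def)
  define C where "C x = {y \<in> carrier G. \<forall>i\<in>A. y i = x i}" for x
  have "\<forall>U\<in>C ` K. openin T U" "K \<subseteq> \<Union>(C ` K)"
    using openin_cylinder[OF A A'] KG by (auto simp: C_def)
  then obtain \<F> where \<F>: "finite \<F>" "\<F> \<subseteq> C ` K" "K \<subseteq> \<Union>\<F>"
    using K unfolding compactin_def by meson
  have one: "finite (D \<inter> U)" if "U \<in> \<F>" for U
  proof -
    obtain z where U: "U = C z"
      using \<F>(2) \<open>U \<in> \<F>\<close> by blast
    have "x = y" if "x \<in> D \<inter> U" "y \<in> D \<inter> U" for x y
    proof (rule ccontr)
      assume "x \<noteq> y"
      then have "p x y \<in> A" "x (p x y) \<noteq> y (p x y)"
        using that p by (auto simp: A_def)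
      then show False
        using that by (auto simp: U C_def)
    qed
    then have "D \<inter> U = {} \<or> (\<exists>x. D \<inter> U = {x})"
      by blast
    then show ?thesis by auto
  qed
  have "D = (\<Union>U\<in>\<F>. D \<inter> U)"
    using D(1) \<F>(3) by blast
  moreover have "finite (\<Union>U\<in>\<F>. D \<inter> U)"
    using \<F>(1) one by blast
  ultimately show False
    using D(3) by simp
qed

subsection \<open>The dual group\<close>

text \<open>For a character and \<open>A \<subseteq> \<tau>\<close>, this triviality means
  dependence on the coordinates in \<open>A\<close> only; no smallest such set is singled
  out.\<close>

definition supported :: "(('i \<Rightarrow> int) \<Rightarrow> complex) \<Rightarrow> 'i set \<Rightarrow> bool" where
  "supported \<phi> A \<longleftrightarrow> (\<forall>x\<in>carrier G. (\<forall>i\<in>A. x i = 0) \<longrightarrow> \<phi> x = 1)"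

text \<open>Addition is modulo two, so the sum of \<open>x\<close> and \<open>y\<close> vanishes
  where they agree; hence the two signs have product \<open>1\<close>.\<close>

lemma supported_agree:
  assumes sgn: "\<And>x. x \<in> carrier G \<Longrightarrow> \<phi> x = 1 \<or> \<phi> x = -1"
    and mult: "\<And>x y. x \<in> carrier G \<Longrightarrow> y \<in> carrier G \<Longrightarrow> \<phi> (x \<otimes>\<^bsub>G\<^esub> y) = \<phi> x * \<phi> y"
    and A: "supported \<phi> A" "A \<subseteq> \<tau>"
    and xy: "x \<in> carrier G" "y \<in> carrier G" "\<forall>i\<in>A. x i = y i"
  shows "\<phi> x = \<phi> y"
proof -
  have "\<forall>i\<in>A. (x \<otimes>\<^bsub>G\<^esub> y) i = 0"
    using xy(3) A(2) by (auto simp: mult_G)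
  then have "\<phi> x * \<phi> y = 1"
    using A(1) mult_in_G[OF xy(1,2)] mult[OF xy(1,2)] by (simp add: supported_def)
  then show ?thesis
    using sgn[OF xy(1)] sgn[OF xy(2)] by auto
qed

lemma carrier_dual_iff:
  "\<phi> \<in> carrier (dual_group K S) \<longleftrightarrow> \<phi> \<in> extensional (carrier K) \<and>
    (\<forall>x\<in>carrier K. \<phi> x \<in> sphere 0 1) \<and>
    (\<forall>x\<in>carrier K. \<forall>y\<in>carrier K. \<phi> (x \<otimes>\<^bsub>K\<^esub> y) = \<phi> x * \<phi> y) \<and>
    continuous_map S circle_topology \<phi>"
  by (auto simp: dual_group_def hom_def circle_group_def Pi_iff)

text \<open>Here \<open>u\<close> is the value of a character at the neutral element and
  \<open>v\<close> its value at an element whose square is neutral. It serves both for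
  \<open>G\<close> and for its dual.\<close>

lemma square_one_character:
  fixes u v :: complex
  assumes "u \<in> sphere 0 1" "u = u * u" "u = v * v"
  shows "v = 1 \<or> v = -1"
proof -
  have "u = 1"
    using assms(1,2) by auto
  then show ?thesis
    using assms(3) square_eq_1_iff by metis
qed

text \<open>This arc excludes \<open>-1\<close>, so a sign lying in it must be
  \<open>1\<close>.\<close>

lemma openin_circle_ball: "openin circle_topology (sphere 0 1 \<inter> ball 1 1)"
  by (simp add: circle_topology_def openin_open_Int)

text \<open>Every element of \<open>G\<close> squares to the neutral one, so all values are signs.
  The preimage of an arc around \<open>1\<close> contains a cylinder around the neutral element, on
  which the character must then be \<open>1\<close>. Conversely, a supported homomorphism is
  constant on cylinders over \<open>A\<close>, so all preimages are open.\<close>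

lemma H_iff:
  "\<phi> \<in> carrier H \<longleftrightarrow> \<phi> \<in> extensional (carrier G) \<and>
    (\<forall>x\<in>carrier G. \<phi> x = 1 \<or> \<phi> x = -1) \<and>
    (\<forall>x\<in>carrier G. \<forall>y\<in>carrier G. \<phi> (x \<otimes>\<^bsub>G\<^esub> y) = \<phi> x * \<phi> y) \<and>
    (\<exists>A. countable A \<and> A \<subseteq> \<tau> \<and> supported \<phi> A)"
  (is "?L \<longleftrightarrow> ?R")
proof
  assume ?L
  then have ext: "\<phi> \<in> extensional (carrier G)"
    and circ: "\<And>x. x \<in> carrier G \<Longrightarrow> \<phi> x \<in> sphere 0 1"
    and mult: "\<And>x y. x \<in> carrier G \<Longrightarrow> y \<in> carrier G \<Longrightarrow> \<phi> (x \<otimes>\<^bsub>G\<^esub> y) = \<phi> x * \<phi> y"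
    and cont: "continuous_map T circle_topology \<phi>"
    unfolding carrier_dual_iff by blast+
  have sgn: "\<phi> x = 1 \<or> \<phi> x = -1" if "x \<in> carrier G" for x
    using square_one_character[OF circ[OF one_in_G]] mult[OF one_in_G one_in_G] mult[OF that that]
    unfolding mult_self_G .
  let ?U = "{x \<in> topspace T. \<phi> x \<in> sphere 0 1 \<inter> ball 1 1}"
  have "openin T ?U"
    using cont openin_circle_ball by (rule openin_continuous_map_preimage)
  moreover have "\<phi> \<one>\<^bsub>G\<^esub> = 1"
    using sgn[OF one_in_G] mult[OF one_in_G one_in_G] mult_self_G[of "\<one>\<^bsub>G\<^esub>"] by auto
  then have "\<one>\<^bsub>G\<^esub> \<in> ?U"
    using one_in_G by (simp add: topspace_G)
  ultimately obtain A where A: "countable A" "A \<subseteq> \<tau>"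
    "\<forall>y\<in>carrier G. (\<forall>i\<in>A. y i = \<one>\<^bsub>G\<^esub> i) \<longrightarrow> y \<in> ?U"
    unfolding openin_G by meson
  have "supported \<phi> A"
    unfolding supported_def
  proof (intro ballI impI)
    fix x assume x: "x \<in> carrier G" "\<forall>i\<in>A. x i = 0"
    then have "x \<in> ?U"
      using A(2) by (intro A(3)[rule_format]) (auto simp: one_G)
    then show "\<phi> x = 1"
      using sgn[OF x(1)] by (auto simp: dist_norm)
  qed
  then show ?R
    using ext sgn mult A by blast
next
  assume R: ?R
  then obtain A where A: "countable A" "A \<subseteq> \<tau>" "supported \<phi> A"
    by blast
  have "continuous_map T circle_topology \<phi>"
    unfolding continuous_map_def
  proof (intro conjI allI impI)
    show "\<phi> \<in> topspace T \<rightarrow> topspace circle_topology"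
      using R by (force simp: topspace_G circle_topology_def)
    fix U assume "openin circle_topology U"
    show "openin T {x \<in> topspace T. \<phi> x \<in> U}"
      unfolding openin_G
    proof (intro conjI ballI)
      fix x assume x: "x \<in> {x \<in> topspace T. \<phi> x \<in> U}"
      have "y \<in> {x \<in> topspace T. \<phi> x \<in> U}" if y: "y \<in> carrier G" "\<forall>i\<in>A. y i = x i" for y
      proof -
        have "\<phi> y = \<phi> x"
          by (rule supported_agree[of \<phi> A]) (use R A x y in \<open>auto simp: topspace_G\<close>)
        then show ?thesis
          using x y(1) by (simp add: topspace_G)
      qed
      then show "\<exists>A. countable A \<and> A \<subseteq> \<tau> \<and>
          (\<forall>y\<in>carrier G. (\<forall>i\<in>A. y i = x i) \<longrightarrow> y \<in> {x \<in> topspace T. \<phi> x \<in> U})"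
        using A(1,2) by blast
    qed (simp add: topspace_G)
  qed
  moreover have "\<phi> x \<in> sphere 0 1" if "x \<in> carrier G" for x
    using R that by force
  ultimately show ?L
    using R unfolding carrier_dual_iff by blast
qed

lemma H_sgn: "\<phi> \<in> carrier H \<Longrightarrow> x \<in> carrier G \<Longrightarrow> \<phi> x = 1 \<or> \<phi> x = -1"
  unfolding H_iff by blast

lemma H_mult: "\<phi> \<in> carrier H \<Longrightarrow> x \<in> carrier G \<Longrightarrow> y \<in> carrier G \<Longrightarrow> \<phi> (x \<otimes>\<^bsub>G\<^esub> y) = \<phi> x * \<phi> y"
  unfolding H_iff by blast

lemma H_supported: "\<phi> \<in> carrier H \<Longrightarrow> \<exists>A. countable A \<and> A \<subseteq> \<tau> \<and> supported \<phi> A"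
  unfolding H_iff by blast

lemma H_agree:
  assumes "\<phi> \<in> carrier H" "supported \<phi> A" "A \<subseteq> \<tau>" "x \<in> carrier G" "y \<in> carrier G" "\<forall>i\<in>A. x i = y i"
  shows "\<phi> x = \<phi> y"
  by (rule supported_agree[of \<phi> A]) (use assms H_sgn H_mult in auto)

lemma mult_H: "\<phi> \<otimes>\<^bsub>H\<^esub> \<psi> = (\<lambda>x\<in>carrier G. \<phi> x * \<psi> x)"
  by (simp add: dual_group_def)

lemma mult_in_H:
  assumes \<phi>: "\<phi> \<in> carrier H" and \<psi>: "\<psi> \<in> carrier H"
  shows "\<phi> \<otimes>\<^bsub>H\<^esub> \<psi> \<in> carrier H"
proof -
  obtain A where A: "countable A" "A \<subseteq> \<tau>" "supported \<phi> A"
    using H_supported[OF \<phi>] by blast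
  obtain B where B: "countable B" "B \<subseteq> \<tau>" "supported \<psi> B"
    using H_supported[OF \<psi>] by blast
  have "supported (\<phi> \<otimes>\<^bsub>H\<^esub> \<psi>) (A \<union> B)"
    using A(3) B(3) by (simp add: supported_def mult_H)
  moreover have "countable (A \<union> B)" "A \<union> B \<subseteq> \<tau>"
    using A B by auto
  moreover have "(\<phi> \<otimes>\<^bsub>H\<^esub> \<psi>) x = 1 \<or> (\<phi> \<otimes>\<^bsub>H\<^esub> \<psi>) x = -1" if "x \<in> carrier G" for x
    using H_sgn[OF \<phi> that] H_sgn[OF \<psi> that] that by (auto simp: mult_H)
  moreover have "(\<phi> \<otimes>\<^bsub>H\<^esub> \<psi>) (x \<otimes>\<^bsub>G\<^esub> y) = (\<phi> \<otimes>\<^bsub>H\<^esub> \<psi>) x * (\<phi> \<otimes>\<^bsub>H\<^esub> \<psi>) y"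
    if "x \<in> carrier G" "y \<in> carrier G" for x y
    using that by (simp add: mult_H mult_in_G H_mult[OF \<phi>] H_mult[OF \<psi>])
  moreover have "\<phi> \<otimes>\<^bsub>H\<^esub> \<psi> \<in> extensional (carrier G)"
    by (simp add: mult_H)
  ultimately show ?thesis
    unfolding H_iff by blast
qed

text \<open>The \<open>i\<close>-th coordinate turned into a sign. These characters separate the
  points of \<open>G\<close> and recover the coordinates of \<open>x\<close> from
  \<open>ev x\<close>.\<close>

definition coord :: "'i \<Rightarrow> ('i \<Rightarrow> int) \<Rightarrow> complex" where
  "coord i = (\<lambda>x\<in>carrier G. if x i = 0 then 1 else -1)"

lemma coord_in_H:
  assumes i: "i \<in> \<tau>" shows "coord i \<in> carrier H"
proof -
  have "coord i (x \<otimes>\<^bsub>G\<^esub> y) = coord i x * coord i y" if "x \<in> carrier G" "y \<in> carrier G" for x y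
    using G_range[OF that(1) i] G_range[OF that(2) i] that i
    by (auto simp: coord_def mult_in_G) (auto simp: mult_G)
  moreover have "supported (coord i) {i}"
    by (simp add: supported_def coord_def)
  then have "\<exists>A. countable A \<and> A \<subseteq> \<tau> \<and> supported (coord i) A"
    using i by (intro exI[of _ "{i}"]) simp
  ultimately show ?thesis
    unfolding H_iff by (simp add: coord_def)
qed

lemma coord_eqD:
  assumes "coord i x = coord i y" "x \<in> carrier G" "y \<in> carrier G" "i \<in> \<tau>"
  shows "x i = y i"
  using assms G_range[OF assms(2,4)] G_range[OF assms(3,4)]
  by (auto simp: coord_def split: if_splits)

text \<open>Compact subsets of \<open>G\<close> are finite, and signs at distance less than
  \<open>1\<close> are equal; uniform closeness on compact sets thus reduces to agreement on finite
  sets.\<close>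

lemma openin_TH:
  "openin TH U \<longleftrightarrow> U \<subseteq> carrier H \<and>
    (\<forall>\<phi>\<in>U. \<exists>F. finite F \<and> F \<subseteq> carrier G \<and> (\<forall>\<psi>\<in>carrier H. (\<forall>x\<in>F. \<psi> x = \<phi> x) \<longrightarrow> \<psi> \<in> U))"
  (is "_ \<longleftrightarrow> _ \<and> ?R")
proof -
  have "(\<forall>\<phi>\<in>U. \<exists>K e. compactin T K \<and> e > 0 \<and>
      {\<psi> \<in> carrier H. \<forall>x\<in>K. dist (\<psi> x) (\<phi> x) < e} \<subseteq> U) \<longleftrightarrow> ?R" if U: "U \<subseteq> carrier H"
  proof (intro ball_cong refl iffI)
    fix \<phi> assume "\<phi> \<in> U"
      and "\<exists>K e. compactin T K \<and> e > 0 \<and> {\<psi> \<in> carrier H. \<forall>x\<in>K. dist (\<psi> x) (\<phi> x) < e} \<subseteq> U"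
    then obtain K e where K: "compactin T K" "e > 0"
      "{\<psi> \<in> carrier H. \<forall>x\<in>K. dist (\<psi> x) (\<phi> x) < e} \<subseteq> U"
      by blast
    have "K \<subseteq> carrier G"
      using compactin_subset_topspace[OF K(1)] by (simp add: topspace_G)
    moreover have "\<forall>\<psi>\<in>carrier H. (\<forall>x\<in>K. \<psi> x = \<phi> x) \<longrightarrow> \<psi> \<in> U"
      using K(2,3) by auto
    ultimately show "\<exists>F. finite F \<and> F \<subseteq> carrier G \<and> (\<forall>\<psi>\<in>carrier H. (\<forall>x\<in>F. \<psi> x = \<phi> x) \<longrightarrow> \<psi> \<in> U)"
      using compactin_G_finite[OF K(1)] by blast
  next
    fix \<phi> assume \<phi>: "\<phi> \<in> U"
      and "\<exists>F. finite F \<and> F \<subseteq> carrier G \<and> (\<forall>\<psi>\<in>carrier H. (\<forall>x\<in>F. \<psi> x = \<phi> x) \<longrightarrow> \<psi> \<in> U)"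
    then obtain F where F: "finite F" "F \<subseteq> carrier G"
      "\<forall>\<psi>\<in>carrier H. (\<forall>x\<in>F. \<psi> x = \<phi> x) \<longrightarrow> \<psi> \<in> U"
      by blast
    have "compactin T F"
      using F(1,2) by (intro finite_imp_compactin) (auto simp: topspace_G)
    moreover have "{\<psi> \<in> carrier H. \<forall>x\<in>F. dist (\<psi> x) (\<phi> x) < 1} \<subseteq> U"
    proof clarify
      fix \<psi> assume \<psi>: "\<psi> \<in> carrier H" "\<forall>x\<in>F. dist (\<psi> x) (\<phi> x) < 1"
      have "\<psi> x = \<phi> x" if "x \<in> F" for x
        using H_sgn[OF \<psi>(1), of x] H_sgn[of \<phi> x] \<psi>(2) that F(2) U \<phi> by (force simp: dist_norm)
      then show "\<psi> \<in> U"
        using F(3) \<psi>(1) by blast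
    qed
    ultimately show "\<exists>K e. compactin T K \<and> e > 0 \<and>
        {\<psi> \<in> carrier H. \<forall>x\<in>K. dist (\<psi> x) (\<phi> x) < e} \<subseteq> U"
      by (intro exI[of _ F] exI[of _ 1]) simp
  qed
  then show ?thesis
    unfolding openin_dual_topology dual_open_def by blast
qed

section \<open>Compact subsets of the dual group\<close>

lemma vec_Un: "X \<inter> Y = {} \<Longrightarrow> vec (X \<union> Y) = vec X \<otimes>\<^bsub>G\<^esub> vec Y"
  by (auto simp: vec_def mult_G fun_eq_iff)

text \<open>The combinatorial result is transferred to characters through \<open>vec\<close>; this
  is what makes the evaluation map continuous.\<close>

lemma compactin_TH_supported:
  assumes K: "compactin TH K"
  shows "\<exists>A. countable A \<and> A \<subseteq> \<tau> \<and> (\<forall>\<phi>\<in>K. supported \<phi> A)"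
proof -
  have KH: "K \<subseteq> carrier H"
    using compactin_subset_topspace[OF K] by simp
  \<comment> \<open>Sets are cut down to \<open>\<tau>\<close> because \<open>vec\<close> sees no
    more of them; thus \<open>X \<in> N\<close> holds exactly when \<open>vec X\<close> lies in
    \<open>G\<close>.\<close>
  define N where "N = {X. X \<inter> \<tau> \<notin> \<xi>}"
  define f where "f \<phi> X = \<phi> (vec X)" for \<phi> :: "('i \<Rightarrow> int) \<Rightarrow> complex" and X
  have vecG: "vec X \<in> carrier G" if "X \<in> N" for X
    using that by (simp add: N_def vec_in_G)
  have sub: "Y \<in> N" if "X \<in> N" "Y \<subseteq> X" for X Y
    using ideal_mono[of "X \<inter> \<tau>" "Y \<inter> \<tau>"] that by (auto simp: N_def)
  have "\<exists>A. countable A \<and> (\<forall>g\<in>f ` K. \<forall>X\<in>N. X \<inter> A = {} \<longrightarrow> g X = 1)"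
  proof (rule compact_family_countable_support[OF sub])
    show "X \<in> N \<or> Y \<in> N" if "X \<inter> Y = {}" for X Y :: "'i set"
      unfolding N_def using disjoint_not_both[of "X \<inter> \<tau>" "Y \<inter> \<tau>"] that by blast
    show "g X = 1 \<or> g X = -1" if gX: "g \<in> f ` K" "X \<in> N" for g X
    proof -
      obtain \<phi> where "\<phi> \<in> K" "g = f \<phi>"
        using gX(1) by blast
      then show ?thesis
        using H_sgn[OF _ vecG[OF gX(2)], of \<phi>] KH by (auto simp: f_def)
    qed
    show "g (X \<union> Y) = g X * g Y" if g: "g \<in> f ` K" and XY: "X \<union> Y \<in> N" "X \<inter> Y = {}" for g X Y
    proof -
      have "vec X \<in> carrier G" "vec Y \<in> carrier G"
        using sub[OF XY(1)] vecG by auto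
      then show ?thesis
        using g KH H_mult by (auto simp: f_def vec_Un[OF XY(2)])
    qed
    show "\<exists>A. countable A \<and> (\<forall>X\<in>N. X \<inter> A = {} \<longrightarrow> g X = 1)" if g: "g \<in> f ` K" for g
    proof -
      obtain \<phi> where \<phi>: "\<phi> \<in> K" "g = f \<phi>"
        using g by blast
      then obtain A where A: "countable A" "A \<subseteq> \<tau>" "supported \<phi> A"
        using H_supported KH by blast
      have "g X = 1" if "X \<in> N" "X \<inter> A = {}" for X
      proof -
        have "\<forall>i\<in>A. vec X i = 0"
          using that(2) A(2) by (auto simp: vec_def)
        then show ?thesis
          using A(3) vecG[OF that(1)] by (simp add: \<phi>(2) f_def supported_def)
      qed
      then show ?thesis
        using A(1) by blast
    qed
    show "\<exists>F. finite F \<and> F \<subseteq> f ` K \<and> (\<forall>g\<in>f ` K. \<exists>h\<in>F. g (X h) = h (X h))"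
      if X: "\<And>g. g \<in> f ` K \<Longrightarrow> X g \<in> N" for X
    proof -
      \<comment> \<open>Agreement with \<open>\<phi>\<close> at a single element of \<open>G\<close>
        is an open condition; a finite subcover yields the finite family required.\<close>
      define U where "U \<phi> = {\<psi> \<in> carrier H. \<psi> (vec (X (f \<phi>))) = \<phi> (vec (X (f \<phi>)))}" for \<phi>
      have "openin TH (U \<phi>)" if "\<phi> \<in> K" for \<phi>
      proof -
        have "vec (X (f \<phi>)) \<in> carrier G"
          using X that vecG by blast
        then show ?thesis
          unfolding openin_TH U_def by (auto intro!: exI[of _ "{vec (X (f \<phi>))}"])
      qed
      moreover have "K \<subseteq> \<Union>(U ` K)"
        using KH by (auto simp: U_def)
      ultimately obtain \<F> where \<F>: "finite \<F>" "\<F> \<subseteq> U ` K" "K \<subseteq> \<Union>\<F>"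
        using compactinD[OF K, of "U ` K"] by auto
      then obtain F where F: "F \<subseteq> K" "finite F" "\<F> = U ` F"
        using finite_subset_image[OF \<F>(1,2)] by blast
      have "\<exists>h\<in>f ` F. g (X h) = h (X h)" if "g \<in> f ` K" for g
        using that \<F>(3) unfolding F(3) U_def f_def by blast
      then show ?thesis
        using F by (intro exI[of _ "f ` F"]) auto
    qed
  qed
  then obtain A where A: "countable A" "\<And>\<phi> X. \<phi> \<in> K \<Longrightarrow> X \<in> N \<Longrightarrow> X \<inter> A = {} \<Longrightarrow> \<phi> (vec X) = 1"
    unfolding f_def by (auto simp: Ball_def)
  have "supported \<phi> (A \<inter> \<tau>)" if \<phi>: "\<phi> \<in> K" for \<phi>
    unfolding supported_def
  proof (intro ballI impI)
    fix x assume x: "x \<in> carrier G" "\<forall>i\<in>A \<inter> \<tau>. x i = 0"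
    define X where "X = {i\<in>\<tau>. x i \<noteq> 0}"
    have "x = vec X"
      unfolding X_def by (rule G_eq_vec[OF x(1)])
    moreover have "X \<in> N"
      using x(1) \<open>x = vec X\<close> by (simp add: N_def vec_in_G)
    moreover have "X \<inter> A = {}"
      using x(2) by (auto simp: X_def)
    ultimately show "\<phi> x = 1"
      using A(2)[OF \<phi>] by simp
  qed
  then show ?thesis
    using A(1) by (intro exI[of _ "A \<inter> \<tau>"]) auto
qed

text \<open>In the compact space of all sign functions on \<open>G\<close> these characters form a
  closed set: a violation is visible at one point (support) or at three points (multiplicativity).
  Since the countable \<open>A\<close> is fixed, pointwise limits remain continuous.\<close>

lemma compactin_supported:
  assumes A: "countable A" "A \<subseteq> \<tau>"
  shows "compactin TH {\<phi> \<in> carrier H. supported \<phi> A}"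
proof -
  define D where "D = {1, -1 :: complex}"
  define X where "X = product_topology (\<lambda>_. discrete_topology D) (carrier G)"
  define K where "K = {\<phi> \<in> carrier H. supported \<phi> A}"
  have KX: "K \<subseteq> topspace X"
  proof
    fix \<phi> assume "\<phi> \<in> K"
    then have "\<phi> \<in> extensional (carrier G)" "\<forall>x\<in>carrier G. \<phi> x \<in> D"
      unfolding K_def H_iff D_def by simp_all
    then show "\<phi> \<in> topspace X"
      by (simp add: X_def PiE_iff)
  qed
  have "openin X (topspace X - K)"
    unfolding X_def openin_product_discrete
  proof (intro conjI ballI)
    fix \<phi> assume "\<phi> \<in> topspace (product_topology (\<lambda>_. discrete_topology D) (carrier G)) - K"
    then have \<phi>: "\<phi> \<in> (\<Pi>\<^sub>E x\<in>carrier G. D)" "\<phi> \<notin> K"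
      by auto
    show "\<exists>F. finite F \<and> F \<subseteq> carrier G \<and> (\<forall>\<psi>\<in>\<Pi>\<^sub>E x\<in>carrier G. D. (\<forall>x\<in>F. \<psi> x = \<phi> x) \<longrightarrow>
        \<psi> \<in> topspace (product_topology (\<lambda>_. discrete_topology D) (carrier G)) - K)"
    proof (cases "supported \<phi> A")
      case False
      then obtain x where x: "x \<in> carrier G" "\<forall>i\<in>A. x i = 0" "\<phi> x \<noteq> 1"
        unfolding supported_def by blast
      have "\<psi> \<notin> K" if "\<psi> x = \<phi> x" for \<psi>
        using x that by (auto simp: K_def supported_def)
      then show ?thesis
        using x(1) by (intro exI[of _ "{x}"]) auto
    next
      case True
      then have "\<not> (\<forall>x\<in>carrier G. \<forall>y\<in>carrier G. \<phi> (x \<otimes>\<^bsub>G\<^esub> y) = \<phi> x * \<phi> y)"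
        using \<phi> A unfolding K_def H_iff by (auto simp: PiE_iff D_def)
      then obtain x y where xy: "x \<in> carrier G" "y \<in> carrier G" "\<phi> (x \<otimes>\<^bsub>G\<^esub> y) \<noteq> \<phi> x * \<phi> y"
        by blast
      have "\<psi> \<notin> K" if "\<forall>z\<in>{x, y, x \<otimes>\<^bsub>G\<^esub> y}. \<psi> z = \<phi> z" for \<psi>
        using xy that H_mult[of \<psi> x y] by (auto simp: K_def)
      then show ?thesis
        using xy(1,2) mult_in_G by (intro exI[of _ "{x, y, x \<otimes>\<^bsub>G\<^esub> y}"]) auto
    qed
  qed auto
  then have "closedin X K"
    using KX by (simp add: closedin_def)
  moreover have "compact_space X"
    unfolding X_def by (simp add: compact_space_product_topology compact_space_discrete_topology D_def)
  ultimately have "compactin X K"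
    by (rule closedin_compact_space[rotated])
  then have "compact_space (subtopology X K)"
    by (rule compact_space_subtopology)
  moreover have "continuous_map (subtopology X K) TH (\<lambda>\<phi>. \<phi>)"
    unfolding continuous_map_def
  proof (intro conjI allI impI)
    show "(\<lambda>\<phi>. \<phi>) \<in> topspace (subtopology X K) \<rightarrow> topspace TH"
      by (auto simp: K_def)
    fix U assume U: "openin TH U"
    \<comment> \<open>\<open>V\<close> extends \<open>U\<close> to arbitrary sign functions by means
      of the finite sets witnessing that \<open>U\<close> is open; on \<open>K\<close> it adds
      nothing to \<open>U\<close>.\<close>
    define V where "V = {\<psi> \<in> (\<Pi>\<^sub>E x\<in>carrier G. D). \<exists>\<phi>\<in>U. \<exists>F. finite F \<and> F \<subseteq> carrier G \<and>
        (\<forall>\<psi>\<in>carrier H. (\<forall>x\<in>F. \<psi> x = \<phi> x) \<longrightarrow> \<psi> \<in> U) \<and> (\<forall>x\<in>F. \<psi> x = \<phi> x)}"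
    have "openin X V"
      unfolding X_def openin_product_discrete
    proof (intro conjI ballI)
      fix \<psi> assume "\<psi> \<in> V"
      then obtain \<phi> F where F: "\<phi> \<in> U" "finite F" "F \<subseteq> carrier G"
        "\<forall>\<psi>\<in>carrier H. (\<forall>x\<in>F. \<psi> x = \<phi> x) \<longrightarrow> \<psi> \<in> U" "\<forall>x\<in>F. \<psi> x = \<phi> x"
        unfolding V_def by blast
      have "\<eta> \<in> V" if "\<eta> \<in> (\<Pi>\<^sub>E x\<in>carrier G. D)" "\<forall>x\<in>F. \<eta> x = \<psi> x" for \<eta>
        unfolding V_def using that F by (intro CollectI conjI bexI[OF _ F(1)] exI[of _ F]) auto
      then show "\<exists>F. finite F \<and> F \<subseteq> carrier G \<and>
          (\<forall>\<eta>\<in>\<Pi>\<^sub>E x\<in>carrier G. D. (\<forall>x\<in>F. \<eta> x = \<psi> x) \<longrightarrow> \<eta> \<in> V)"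
        using F(2,3) by blast
    qed (auto simp: V_def)
    moreover have "{\<phi> \<in> topspace (subtopology X K). \<phi> \<in> U} = V \<inter> K"
    proof -
      have "\<phi> \<in> V" if "\<phi> \<in> U" "\<phi> \<in> K" for \<phi>
      proof -
        have "\<exists>F. finite F \<and> F \<subseteq> carrier G \<and> (\<forall>\<psi>\<in>carrier H. (\<forall>x\<in>F. \<psi> x = \<phi> x) \<longrightarrow> \<psi> \<in> U)"
          using U that(1) unfolding openin_TH by simp
        moreover have "\<phi> \<in> (\<Pi>\<^sub>E x\<in>carrier G. D)"
          using KX that(2) by (auto simp: X_def)
        ultimately show ?thesis
          unfolding V_def using that(1) by blast
      qed
      moreover have "\<phi> \<in> U" if "\<phi> \<in> V" "\<phi> \<in> K" for \<phi>
        using that by (auto simp: V_def K_def)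
      ultimately show ?thesis
        using KX by auto
    qed
    ultimately show "openin (subtopology X K) {\<phi> \<in> topspace (subtopology X K). \<phi> \<in> U}"
      by (auto simp: openin_subtopology)
  qed
  ultimately have "compactin TH ((\<lambda>\<phi>. \<phi>) ` topspace (subtopology X K))"
    unfolding compact_space_def by (rule image_compactin)
  then show ?thesis
    using KX by (simp add: K_def Int_absorb1)
qed

subsection \<open>The second dual group\<close>

abbreviation "HH \<equiv> dual_group H TH"
abbreviation "THH \<equiv> dual_topology H TH"

lemma one_in_H: "(\<lambda>x\<in>carrier G. 1) \<in> carrier H"
  unfolding H_iff using mult_in_G
  by (auto simp: supported_def intro!: exI[of _ "{}"])

lemma mult_self_H: "\<phi> \<in> carrier H \<Longrightarrow> \<phi> \<otimes>\<^bsub>H\<^esub> \<phi> = (\<lambda>x\<in>carrier G. 1)"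
  using H_sgn by (force simp: mult_H intro!: restrict_ext)

lemma HH_mult: "f \<in> carrier HH \<Longrightarrow> \<phi> \<in> carrier H \<Longrightarrow> \<psi> \<in> carrier H \<Longrightarrow> f (\<phi> \<otimes>\<^bsub>H\<^esub> \<psi>) = f \<phi> * f \<psi>"
  unfolding carrier_dual_iff[of f] by blast

lemma HH_sgn:
  assumes f: "f \<in> carrier HH" and \<phi>: "\<phi> \<in> carrier H"
  shows "f \<phi> = 1 \<or> f \<phi> = -1"
proof (rule square_one_character)
  let ?e = "\<lambda>x\<in>carrier G. 1 :: complex"
  show "f ?e \<in> sphere 0 1"
    using f one_in_H unfolding carrier_dual_iff[of f] by blast
  show "f ?e = f ?e * f ?e"
    using HH_mult[OF f one_in_H one_in_H] mult_self_H[OF one_in_H] by simp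
  show "f ?e = f \<phi> * f \<phi>"
    using HH_mult[OF f \<phi> \<phi>] mult_self_H[OF \<phi>] by simp
qed

text \<open>Continuity at the trivial character: the preimage of an arc around \<open>1\<close>
  contains all characters trivial on some finite \<open>F\<close>, and \<open>f\<close>, being a
  sign, equals \<open>1\<close> on them.\<close>

lemma HH_finite_kernel:
  assumes f: "f \<in> carrier HH"
  shows "\<exists>F. finite F \<and> F \<subseteq> carrier G \<and> (\<forall>\<phi>\<in>carrier H. (\<forall>x\<in>F. \<phi> x = 1) \<longrightarrow> f \<phi> = 1)"
proof -
  let ?e = "\<lambda>x\<in>carrier G. 1 :: complex"
  let ?U = "{\<phi> \<in> topspace TH. f \<phi> \<in> sphere 0 1 \<inter> ball 1 1}"
  have "continuous_map TH circle_topology f"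
    using f unfolding carrier_dual_iff[of f] by blast
  then have "openin TH ?U"
    using openin_circle_ball by (rule openin_continuous_map_preimage)
  moreover have "f ?e = 1"
    using HH_sgn[OF f one_in_H] HH_mult[OF f one_in_H one_in_H] mult_self_H[OF one_in_H] by auto
  then have "?e \<in> ?U"
    using one_in_H by simp
  ultimately have "\<exists>F. finite F \<and> F \<subseteq> carrier G \<and>
      (\<forall>\<phi>\<in>carrier H. (\<forall>x\<in>F. \<phi> x = ?e x) \<longrightarrow> \<phi> \<in> ?U)"
    unfolding openin_TH by (elim conjE) (erule bspec)
  then obtain F where F: "finite F" "F \<subseteq> carrier G"
    "\<forall>\<phi>\<in>carrier H. (\<forall>x\<in>F. \<phi> x = ?e x) \<longrightarrow> \<phi> \<in> ?U"
    by (elim exE conjE)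
  have "f \<phi> = 1" if "\<phi> \<in> carrier H" "\<forall>x\<in>F. \<phi> x = 1" for \<phi>
  proof -
    have "\<phi> \<in> ?U"
      using that F(2) by (intro F(3)[rule_format]) auto
    then show ?thesis
      using HH_sgn[OF f that(1)] by (auto simp: dist_norm)
  qed
  then show ?thesis
    using F(1,2) by blast
qed

text \<open>Over the field with two elements, a functional vanishing on the common kernel of finitely
  many evaluations is a combination of these evaluations.\<close>

lemma finite_kernel_imp_evaluation:
  assumes "finite F" "F \<subseteq> carrier G"
    and "\<And>\<phi>. \<phi> \<in> carrier H \<Longrightarrow> f \<phi> = 1 \<or> f \<phi> = -1"
    and "\<And>\<phi> \<psi>. \<phi> \<in> carrier H \<Longrightarrow> \<psi> \<in> carrier H \<Longrightarrow> f (\<phi> \<otimes>\<^bsub>H\<^esub> \<psi>) = f \<phi> * f \<psi>"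
    and "\<And>\<phi>. \<phi> \<in> carrier H \<Longrightarrow> (\<forall>x\<in>F. \<phi> x = 1) \<Longrightarrow> f \<phi> = 1"
  shows "\<exists>x\<in>carrier G. \<forall>\<phi>\<in>carrier H. f \<phi> = \<phi> x"
  using assms
proof (induction F arbitrary: f rule: finite_induct)
  case empty
  have "\<phi> \<one>\<^bsub>G\<^esub> = 1" if "\<phi> \<in> carrier H" for \<phi>
    using H_sgn[OF that one_in_G] H_mult[OF that one_in_G one_in_G] mult_self_G[of "\<one>\<^bsub>G\<^esub>"] by auto
  then show ?case
    using empty one_in_G by (intro bexI[of _ "\<one>\<^bsub>G\<^esub>"]) auto
next
  case (insert x0 F)
  have x0: "x0 \<in> carrier G" and FG: "F \<subseteq> carrier G"
    using insert.prems(1) by auto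
  show ?case
  proof (cases "\<forall>\<phi>\<in>carrier H. (\<forall>x\<in>F. \<phi> x = 1) \<longrightarrow> f \<phi> = 1")
    case True
    then show ?thesis
      by (intro insert.IH[OF FG insert.prems(2,3)]) auto
  next
    case False
    then obtain \<phi>0 where \<phi>0: "\<phi>0 \<in> carrier H" "\<forall>x\<in>F. \<phi>0 x = 1" "f \<phi>0 \<noteq> 1"
      by blast
    then have f0: "f \<phi>0 = -1"
      using insert.prems(2) by blast
    have "\<phi>0 x0 \<noteq> 1"
      using insert.prems(4)[OF \<phi>0(1)] \<phi>0(2,3) by auto
    then have \<phi>0x: "\<phi>0 x0 = -1"
      using H_sgn[OF \<phi>0(1) x0] by blast
    \<comment> \<open>Both \<open>f\<close> and evaluation at \<open>x0\<close> are
      \<open>-1\<close> at \<open>\<phi>0\<close>, so their product is trivial there. This removes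
      the dependence on \<open>x0\<close> and makes the induction hypothesis for \<open>F\<close>
      applicable.\<close>
    define g where "g \<phi> = f \<phi> * \<phi> x0" for \<phi>
    have "\<exists>x\<in>carrier G. \<forall>\<phi>\<in>carrier H. g \<phi> = \<phi> x"
    proof (rule insert.IH[OF FG])
      show "g \<phi> = 1 \<or> g \<phi> = -1" if "\<phi> \<in> carrier H" for \<phi>
        using insert.prems(2)[OF that] H_sgn[OF that x0] by (auto simp: g_def)
      show "g (\<phi> \<otimes>\<^bsub>H\<^esub> \<psi>) = g \<phi> * g \<psi>" if "\<phi> \<in> carrier H" "\<psi> \<in> carrier H" for \<phi> \<psi>
        using insert.prems(3)[OF that] x0 by (simp add: g_def) (simp add: mult_H)
      show "g \<phi> = 1" if \<phi>: "\<phi> \<in> carrier H" "\<forall>x\<in>F. \<phi> x = 1" for \<phi>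
      proof (cases "\<phi> x0 = 1")
        case True
        then show ?thesis
          using insert.prems(4)[OF \<phi>(1)] \<phi>(2) by (simp add: g_def)
      next
        case False
        then have \<phi>x: "\<phi> x0 = -1"
          using H_sgn[OF \<phi>(1) x0] by blast
        \<comment> \<open>Multiplying by \<open>\<phi>0\<close> corrects the sign at
          \<open>x0\<close> without changing the values on \<open>F\<close>.\<close>
        have "f (\<phi> \<otimes>\<^bsub>H\<^esub> \<phi>0) = 1"
          by (rule insert.prems(4)[OF mult_in_H[OF \<phi>(1) \<phi>0(1)]])
            (use \<phi>x \<phi>0x \<phi>(2) \<phi>0(2) x0 FG in \<open>auto simp: mult_H\<close>)
        then have "f \<phi> * f \<phi>0 = 1"
          using insert.prems(3)[OF \<phi>(1) \<phi>0(1)] by simp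
        then show ?thesis
          using f0 \<phi>x by (simp add: g_def)
      qed
    qed
    then obtain y where y: "y \<in> carrier G" "\<And>\<phi>. \<phi> \<in> carrier H \<Longrightarrow> g \<phi> = \<phi> y"
      by blast
    have "f \<phi> = \<phi> (y \<otimes>\<^bsub>G\<^esub> x0)" if "\<phi> \<in> carrier H" for \<phi>
    proof -
      have "\<phi> (y \<otimes>\<^bsub>G\<^esub> x0) = f \<phi> * \<phi> x0 * \<phi> x0"
        using H_mult[OF that y(1) x0] y(2)[OF that] by (simp add: g_def)
      then show ?thesis
        using H_sgn[OF that x0] by auto
    qed
    then show ?thesis
      using mult_in_G[OF y(1) x0] by blast
  qed
qed

section \<open>The evaluation map\<close>

abbreviation "ev \<equiv> evaluation G T"

lemma ev_apply: "\<phi> \<in> carrier H \<Longrightarrow> ev x \<phi> = \<phi> x"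
  by (simp add: evaluation_def)

lemma ev_in_HH:
  assumes x: "x \<in> carrier G" shows "ev x \<in> carrier HH"
proof -
  have "continuous_map TH circle_topology (ev x)"
    unfolding continuous_map_def
  proof (intro conjI allI impI)
    have "\<phi> x \<in> sphere 0 1" if "\<phi> \<in> carrier H" for \<phi>
      using H_sgn[OF that x] by auto
    then show "ev x \<in> topspace TH \<rightarrow> topspace circle_topology"
      by (auto simp: circle_topology_def ev_apply)
    fix U assume "openin circle_topology U"
    show "openin TH {\<phi> \<in> topspace TH. ev x \<phi> \<in> U}"
      unfolding openin_TH using x by (auto simp: ev_apply intro!: exI[of _ "{x}"])
  qed
  moreover have "ev x \<phi> \<in> sphere 0 1" if "\<phi> \<in> carrier H" for \<phi>
    using H_sgn[OF that x] that by (auto simp: ev_apply)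
  moreover have "ev x (\<phi> \<otimes>\<^bsub>H\<^esub> \<psi>) = ev x \<phi> * ev x \<psi>" if "\<phi> \<in> carrier H" "\<psi> \<in> carrier H" for \<phi> \<psi>
    using that x by (simp add: ev_apply mult_in_H) (simp add: mult_H)
  moreover have "ev x \<in> extensional (carrier H)"
    by (simp add: evaluation_def)
  ultimately show ?thesis
    unfolding carrier_dual_iff[of "ev x"] by blast
qed

lemma inj_ev: "inj_on ev (carrier G)"
proof (rule inj_onI)
  fix x y assume xy: "x \<in> carrier G" "y \<in> carrier G" "ev x = ev y"
  show "x = y"
  proof (rule G_ext[OF xy(1,2)])
    fix i assume i: "i \<in> \<tau>"
    have "coord i x = coord i y"
      using xy(3) ev_apply[OF coord_in_H[OF i]] by metis
    then show "x i = y i"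
      by (rule coord_eqD[OF _ xy(1,2) i])
  qed
qed

lemma image_ev: "ev ` carrier G = carrier HH"
proof
  show "ev ` carrier G \<subseteq> carrier HH"
    using ev_in_HH by blast
  show "carrier HH \<subseteq> ev ` carrier G"
  proof
    fix f assume f: "f \<in> carrier HH"
    obtain F where F: "finite F" "F \<subseteq> carrier G"
      "\<And>\<phi>. \<phi> \<in> carrier H \<Longrightarrow> (\<forall>x\<in>F. \<phi> x = 1) \<Longrightarrow> f \<phi> = 1"
      using HH_finite_kernel[OF f] by blast
    have "\<exists>x\<in>carrier G. \<forall>\<phi>\<in>carrier H. f \<phi> = \<phi> x"
      by (rule finite_kernel_imp_evaluation[OF F(1,2) HH_sgn[OF f] HH_mult[OF f] F(3)])
    then obtain x where x: "x \<in> carrier G" "\<forall>\<phi>\<in>carrier H. f \<phi> = \<phi> x"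
      by blast
    have "f = ev x"
    proof (rule extensionalityI[of _ "carrier H"])
      show "f \<in> extensional (carrier H)"
        using f unfolding carrier_dual_iff[of f] by blast
    qed (use x in \<open>auto simp: evaluation_def\<close>)
    then show "f \<in> ev ` carrier G"
      using x(1) by blast
  qed
qed

lemma iso_ev: "ev \<in> iso G HH"
proof -
  have "ev (x \<otimes>\<^bsub>G\<^esub> y) = ev x \<otimes>\<^bsub>HH\<^esub> ev y" if "x \<in> carrier G" "y \<in> carrier G" for x y
    using that by (auto simp: dual_group_def[of H] evaluation_def H_mult intro!: restrict_ext)
  then have "ev \<in> hom G HH"
    using ev_in_HH by (auto simp: hom_def)
  then show ?thesis
    using inj_ev image_ev by (simp add: iso_def bij_betw_def)
qed

text \<open>The equivalence has the form of the quotient-map condition, so that with bijectivity it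
  gives a homeomorphism. From left to right, the compact set of all characters supported by
  \<open>A\<close> is used; from right to left, the common countable support of a compact
  set.\<close>

lemma open_ev:
  assumes U: "U \<subseteq> carrier HH"
  shows "openin T {x \<in> carrier G. ev x \<in> U} \<longleftrightarrow> openin THH U"
proof
  assume V: "openin T {x \<in> carrier G. ev x \<in> U}"
  show "openin THH U"
    unfolding openin_dual_topology dual_open_def
  proof (intro conjI ballI U)
    fix f assume f: "f \<in> U"
    then obtain x where x: "x \<in> carrier G" "f = ev x"
      using U image_ev by blast
    then have "x \<in> {x \<in> carrier G. ev x \<in> U}"
      using f by simp
    then have "\<exists>A. countable A \<and> A \<subseteq> \<tau> \<and>
        (\<forall>y\<in>carrier G. (\<forall>i\<in>A. y i = x i) \<longrightarrow> y \<in> {x \<in> carrier G. ev x \<in> U})"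
      using V unfolding openin_G by (elim conjE) (erule bspec)
    then obtain A where A: "countable A" "A \<subseteq> \<tau>"
      "\<And>y. y \<in> carrier G \<Longrightarrow> (\<forall>i\<in>A. y i = x i) \<Longrightarrow> ev y \<in> U"
      by auto
    define K where "K = {\<phi> \<in> carrier H. supported \<phi> A}"
    \<comment> \<open>The coordinate characters over \<open>A\<close> belong to the compact set
      \<open>K\<close>, so closeness on \<open>K\<close> forces agreement at every coordinate in
      \<open>A\<close>.\<close>
    have coordK: "coord i \<in> K" if "i \<in> A" for i
      using that A(2) coord_in_H[of i] by (auto simp: K_def supported_def coord_def)
    have "g \<in> U" if g: "g \<in> carrier HH" "\<forall>\<phi>\<in>K. dist (g \<phi>) (f \<phi>) < 1" for g
    proof -
      obtain y where y: "y \<in> carrier G" "g = ev y"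
        using g(1) image_ev by blast
      have "y i = x i" if i: "i \<in> A" for i
      proof (rule coord_eqD[OF _ y(1) x(1)])
        have iH: "coord i \<in> carrier H"
          using coordK[OF i] by (simp add: K_def)
        have "dist (coord i y) (coord i x) < 1"
          using bspec[OF g(2) coordK[OF i]] unfolding x(2) y(2) ev_apply[OF iH] .
        then show "coord i y = coord i x"
          using H_sgn[OF iH x(1)] H_sgn[OF iH y(1)] by (auto simp: dist_norm)
        show "i \<in> \<tau>"
          using i A(2) by blast
      qed
      then show ?thesis
        using A(3)[OF y(1)] y(2) by blast
    qed
    moreover have "compactin TH K"
      unfolding K_def by (rule compactin_supported[OF A(1,2)])
    ultimately show "\<exists>K e. compactin TH K \<and> e > 0 \<and>
        {g \<in> carrier HH. \<forall>\<phi>\<in>K. dist (g \<phi>) (f \<phi>) < e} \<subseteq> U"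
      by (intro exI[of _ K] exI[of _ "1::real"]) auto
  qed
next
  assume W: "openin THH U"
  show "openin T {x \<in> carrier G. ev x \<in> U}"
    unfolding openin_G
  proof (intro conjI ballI)
    fix x assume "x \<in> {x \<in> carrier G. ev x \<in> U}"
    then have x: "x \<in> carrier G" "ev x \<in> U"
      by auto
    have "\<exists>K e. compactin TH K \<and> e > 0 \<and> {g \<in> carrier HH. \<forall>\<phi>\<in>K. dist (g \<phi>) (ev x \<phi>) < e} \<subseteq> U"
      using W x(2) unfolding openin_dual_topology dual_open_def by (elim conjE) (erule bspec)
    then obtain K e where K: "compactin TH K" "e > 0"
      "{g \<in> carrier HH. \<forall>\<phi>\<in>K. dist (g \<phi>) (ev x \<phi>) < e} \<subseteq> U"
      by (elim exE conjE)
    obtain A where A: "countable A" "A \<subseteq> \<tau>" "\<And>\<phi>. \<phi> \<in> K \<Longrightarrow> supported \<phi> A"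
      using compactin_TH_supported[OF K(1)] by metis
    have KH: "K \<subseteq> carrier H"
      using compactin_subset_topspace[OF K(1)] by simp
    have "ev y \<in> U" if y: "y \<in> carrier G" "\<forall>i\<in>A. y i = x i" for y
    proof -
      \<comment> \<open>Agreement on the common support makes the evaluations coincide on
        \<open>K\<close>, so any \<open>e > 0\<close> is good enough.\<close>
      have "ev y \<phi> = ev x \<phi>" if "\<phi> \<in> K" for \<phi>
        using H_agree[OF _ A(3)[OF that] A(2) y(1) x(1) y(2)] that KH by (auto simp: ev_apply)
      then show ?thesis
        using K(2,3) ev_in_HH[OF y(1)] by auto
    qed
    then show "\<exists>A. countable A \<and> A \<subseteq> \<tau> \<and>
        (\<forall>y\<in>carrier G. (\<forall>i\<in>A. y i = x i) \<longrightarrow> y \<in> {x \<in> carrier G. ev x \<in> U})"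
      using A(1,2) by blast
  qed simp
qed

lemma reflexive_G: "reflexive_group G T"
  unfolding reflexive_group_def
proof (intro conjI topological_group_G comm_group_G iso_ev)
  show "homeomorphic_map T THH ev"
    unfolding homeomorphic_map_def quotient_map_def
    using image_ev inj_ev open_ev by (simp add: topspace_G)
qed

end

theorem theorem8:
  fixes \<tau> :: "'i set" and \<xi> :: "'i set set"
  assumes "uncountable \<tau>"
    and "ultrafilter_on \<tau> \<xi>"
    and "\<And>C. C \<subseteq> \<tau> \<Longrightarrow> countable C \<Longrightarrow> \<tau> - C \<in> \<xi>"
  shows "subgroup (G_sub \<tau> \<xi>) (Z2_power \<tau>)
    \<and> G_topology \<tau> \<xi> \<noteq> discrete_topology (G_sub \<tau> \<xi>)
    \<and> P_group (G_group \<tau> \<xi>) (G_topology \<tau> \<xi>)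
    \<and> reflexive_group (G_group \<tau> \<xi>) (G_topology \<tau> \<xi>)"
proof -
  interpret ultrafilter_subgroup \<tau> \<xi>
    by (rule ultrafilter_subgroup.intro) (fact assms)+
  show ?thesis
    using subgroup_G nondiscrete_G P_group_G reflexive_G by blast
qed

end
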